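(* Let $$\varepsilon=\inf\{h(\phi)>0: G\text{ abelian group},\ \phi\in\mathrm{End}(G)\}\quad\text{and}\quad \mathfrak L=\inf\{m(f(t))>0: f(t)\in\mathbb Z[t]\text{ primitive}\}.$$ Then $$\varepsilon=\inf\{h(\phi)>0: n\in\mathbb N_+,\ \phi\in\mathrm{Aut}(\mathbb Q^n)\}=\mathfrak L.$$
   Context: $\mathbb N_+$ is the set of positive integers. A notation such as $\inf\{h(\phi)>0:\ldots\}$ means the infimum of the strictly positive values of $h(\phi)$ under the stated conditions. Algebraic entropy: for an abelian group $G$, $[G]^{<\omega}$ denotes the family of all non-empty finite subsets of $G$. For $\phi\in\mathrm{End}(G)$, $F\in[G]^{<\omega}$ and $n\in\mathbb N_+$ let $T_n(\phi,F)=F+\phi(F)+\ldots+\phi^{n-1}(F)$ and $H(\phi,F)=\lim_{n\to\infty}\frac{\log|T_n(\phi,F)|}{n}$ (this limit always exists). The algebraic entropy is $h(\phi)=\sup\{H(\phi,F):F\in[G]^{<\omega}\}\in[0,\infty]$. Mahler measure: for a primitive polynomial $f(t)=a_0+a_1t+\ldots+a_kt^k\in\mathbb Z[t]$ of degree $k$ with complex roots $\alpha_1,\ldots,\alpha_k$ (with multiplicity), $m(f(t))=\log|a_k|+\sum_{|\alpha_i|>1}\log|\alpha_i|$. *)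

theory Defs
  imports
    Complex_Main
    "HOL-Library.Extended_Real"
    "HOL-Algebra.Coset"
    "HOL-Computational_Algebra.Polynomial"
    "Jordan_Normal_Form.Matrix"
begin

text \<open>
  Abelian groups are commutative groups of \<open>HOL-Algebra\<close>, hence written multiplicatively:
  the sumset \<open>A + B\<close> is \<open>A <#> B\<close>. The group \<open>\<rat>\<^sup>n\<close> is \<open>monoid_vec TYPE(rat) n\<close>.
\<close>

text \<open>\<open>T_n(\<phi>, F) = F + \<phi>(F) + \<dots> + \<phi>\<^sup>n\<^sup>-\<^sup>1(F)\<close>; the empty sum, for \<open>n = 0\<close>, is the trivial subgroup.\<close>

primrec trajectory :: "'a monoid \<Rightarrow> ('a \<Rightarrow> 'a) \<Rightarrow> 'a set \<Rightarrow> nat \<Rightarrow> 'a set" where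
  "trajectory G \<phi> F 0 = {\<one>\<^bsub>G\<^esub>}"
| "trajectory G \<phi> F (Suc n) = trajectory G \<phi> F n <#>\<^bsub>G\<^esub> ((\<phi> ^^ n) ` F)"

definition entropy_at :: "'a monoid \<Rightarrow> ('a \<Rightarrow> 'a) \<Rightarrow> 'a set \<Rightarrow> real" where
  "entropy_at G \<phi> F = lim (\<lambda>n. ln (real (card (trajectory G \<phi> F n))) / real n)"

definition algebraic_entropy :: "'a monoid \<Rightarrow> ('a \<Rightarrow> 'a) \<Rightarrow> ereal" where
  "algebraic_entropy G \<phi> =
     (SUP F \<in> {F. F \<subseteq> carrier G \<and> finite F \<and> F \<noteq> {}}. ereal (entropy_at G \<phi> F))"

text \<open>Roots are taken in \<open>\<complex>\<close> and counted with multiplicity (\<open>proots\<close> is a multiset).\<close>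

definition log_mahler_measure :: "int poly \<Rightarrow> real" where
  "log_mahler_measure f =
     ln \<bar>real_of_int (lead_coeff f)\<bar>
     + (\<Sum>\<alpha>\<in>#{#\<alpha> \<in># proots (map_poly (of_int :: int \<Rightarrow> complex) f). cmod \<alpha> > 1#}. ln (cmod \<alpha>))"

text \<open>
  HOL has no set of all groups, so the infimum over all abelian groups is taken over those whose
  carrier is a subset of a type \<open>'a\<close>. A statement about \<open>entropy_inf TYPE('a)\<close> for an arbitrary
  infinite type \<open>'a\<close> covers abelian groups of every cardinality. Infiniteness is needed only
  because on a finite type all entropies vanish and the infimum is over the empty set.
  All infima are taken in \<open>ereal\<close>, since the entropy may be infinite.
\<close>

definition entropy_inf :: "'a itself \<Rightarrow> ereal" where
  "entropy_inf _ =
     Inf {algebraic_entropy G \<phi> | (G :: 'a monoid) \<phi>.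
            comm_group G \<and> \<phi> \<in> hom G G \<and> 0 < algebraic_entropy G \<phi>}"

definition rat_aut_entropy_inf :: ereal where
  "rat_aut_entropy_inf =
     Inf {algebraic_entropy (monoid_vec TYPE(rat) n) \<phi> | n \<phi>.
            0 < n \<and> \<phi> \<in> iso (monoid_vec TYPE(rat) n) (monoid_vec TYPE(rat) n) \<and>
            0 < algebraic_entropy (monoid_vec TYPE(rat) n) \<phi>}"

definition lehmer_inf :: ereal where
  "lehmer_inf =
     Inf {ereal (log_mahler_measure f) | f. content f = 1 \<and> 0 < log_mahler_measure f}"

end

theory Submission
  imports
    Defs
    "Jordan_Normal_Form.Char_Poly"
    "HOL-Computational_Algebra.Polynomial_Factorial"
    "HOL-Library.Countable_Set"
    "HOL-Real_Asymp.Real_Asymp"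
begin

text \<open>
  For \<open>x\<close> in an abelian group with endomorphism \<open>\<phi>\<close>, the subgroup generated by the \<open>\<phi>\<close>-orbit
  of \<open>x\<close> is \<open>\<int>[t]/I\<close> with \<open>\<phi>\<close> acting as multiplication by \<open>t\<close>, and the trajectories of
  \<open>{-Bx, \<dots>, Bx}\<close> are the images of the integer polynomials of bounded degree and height at most
  \<open>B\<close>. So everything reduces to counting such polynomials modulo some \<open>f\<close>, where the count grows
  like \<open>exp (n m(f))\<close>.

  Upper bound: modulo \<open>f\<close> the coefficients beyond the degree of \<open>f\<close> can be reduced modulo the leading
  coefficient \<open>a\<close>, which leaves at most \<open>\<bar>a\<bar>\<^sup>n\<close> cases. In each case the remainder is an integer vector,
  determined by its Newton coordinates at the roots of \<open>f\<close> up to a fixed precision, and the coordinate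
  belonging to the root \<open>\<alpha>\<close> has size at most \<open>max 1 \<bar>\<alpha>\<bar> ^ n\<close> up to a polynomial factor.

  Lower bound: \<open>\<int>[t]/(f, t\<^sup>n - 2)\<close> has at least \<open>\<Prod>\<bar>f(\<omega>)\<bar> = \<bar>a\<bar>\<^sup>n \<Prod>\<bar>\<alpha>\<^sup>n - 2\<bar>\<close> elements, the product
  running over \<open>\<omega>\<^sup>n = 2\<close> and over the roots \<open>\<alpha>\<close> of \<open>f\<close>, and each class has a representative of height at
  most three times the sum of the absolute values of the coefficients of \<open>f\<close>. Taking \<open>2\<close> in place of
  \<open>1\<close> keeps roots of \<open>f\<close> on the unit circle harmless.

  If \<open>h(\<phi>) > 0\<close>, then some cyclic \<open>\<int>[t]/I\<close> has positive entropy, since \<open>H(\<phi>, F)\<close> is subadditive in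
  \<open>F\<close>. Either \<open>I\<close> is contained in \<open>(c)\<close> with \<open>c \<ge> 2\<close>, and \<open>h(\<phi>) \<ge> log 2 \<ge> \<L>\<close>, or \<open>I\<close> differs from
  \<open>(f)\<close>, \<open>f\<close> primitive, by a finite module, and then \<open>0 < m(f) \<le> h(\<phi>)\<close>. Conversely \<open>m(f)\<close> is the
  entropy of multiplication by \<open>t\<close> on \<open>\<rat>[t]/(f)\<close>, an automorphism as soon as \<open>f(0) \<noteq> 0\<close>.
\<close>

subsection \<open>Ideals of integer polynomials\<close>

hide_const (open) Module.smult

definition poly_ideal :: "int poly set \<Rightarrow> bool" where
  "poly_ideal I \<longleftrightarrow> 0 \<in> I \<and> (\<forall>p\<in>I. \<forall>q\<in>I. p + q \<in> I) \<and> (\<forall>p\<in>I. \<forall>r. r * p \<in> I)"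

lemma poly_ideal_add: "poly_ideal I \<Longrightarrow> p \<in> I \<Longrightarrow> q \<in> I \<Longrightarrow> p + q \<in> I"
  and poly_ideal_mult: "poly_ideal I \<Longrightarrow> p \<in> I \<Longrightarrow> r * p \<in> I"
  and poly_ideal_mult_right: "poly_ideal I \<Longrightarrow> p \<in> I \<Longrightarrow> p * r \<in> I"
  by (auto simp: poly_ideal_def mult.commute)

lemma poly_ideal_smult: "poly_ideal I \<Longrightarrow> p \<in> I \<Longrightarrow> smult c p \<in> I"
  using poly_ideal_mult[of I p "[:c:]"] by simp

lemma poly_ideal_diff: "poly_ideal I \<Longrightarrow> p \<in> I \<Longrightarrow> q \<in> I \<Longrightarrow> p - q \<in> I"
  using poly_ideal_add[of I p "- q"] poly_ideal_smult[of I q "-1"] by simp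

text \<open>Gauss's lemma: in \<open>smult c q = w * s\<close> the content of \<open>s\<close> is
  divisible by \<open>c\<close>, so \<open>c\<close> cancels.\<close>

lemma primitive_dvd_smultD:
  fixes w q :: "int poly"
  assumes "content w = 1" "c \<noteq> 0" "w dvd smult c q"
  shows "w dvd q"
proof -
  obtain s where s: "smult c q = w * s" using assms(3) by (rule dvdE)
  have "content (w * s) = content s" using assms(1) by (simp add: content_mult)
  hence "content s = normalize c * content q" using s by (metis content_smult)
  hence "[:c:] dvd s" by (simp add: const_poly_dvd_iff_dvd_content)
  then obtain s' where s': "s = [:c:] * s'" by (rule dvdE)
  have "smult c q = smult c (w * s')" using s s' by simp
  hence "q = w * s'" using assms(2) smult_cancel by blast
  thus ?thesis by simp
qed

text \<open>Over the rationals \<open>I\<close> is generated by a nonzero element \<open>v\<close>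
  of least degree: pseudo-division by \<open>v\<close> leaves zero, and Gauss's lemma removes the
  scalar. Then \<open>w\<close> is the primitive part of \<open>v\<close> and \<open>N\<close> the
  content of \<open>v\<close>.\<close>

lemma poly_ideal_gcd_exists:
  assumes I: "poly_ideal I" and nz: "\<exists>p\<in>I. p \<noteq> 0"
  obtains w N where "content w = 1" "N \<noteq> 0" "\<forall>q\<in>I. w dvd q" "smult N w \<in> I"
proof -
  obtain v where v: "v \<in> I" "v \<noteq> 0" and min: "\<And>u. u \<in> I \<Longrightarrow> u \<noteq> 0 \<Longrightarrow> degree v \<le> degree u"
    using ex_has_least_nat[of "\<lambda>p. p \<in> I \<and> p \<noteq> 0" _ degree] nz by blast
  define w where "w = primitive_part v"
  have vw: "v = smult (content v) w" by (simp add: w_def)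
  have cw: "content w = 1" using v by (simp add: w_def)
  have "w dvd q" if q: "q \<in> I" for q
  proof -
    obtain c s where cs: "c \<noteq> 0" "smult c q = v * s + pseudo_mod q v"
      and r: "pseudo_mod q v = 0 \<or> degree (pseudo_mod q v) < degree v"
      using pseudo_mod[OF v(2)] by blast
    have "pseudo_mod q v = smult c q - v * s" using cs by simp
    hence "pseudo_mod q v \<in> I"
      using I q v by (simp add: poly_ideal_diff poly_ideal_smult poly_ideal_mult_right)
    hence "pseudo_mod q v = 0" using r min by fastforce
    hence "w dvd smult c q" using cs vw by (metis add.right_neutral dvd_smult dvd_triv_left mult_smult_left)
    thus ?thesis using primitive_dvd_smultD cw cs by blast
  qed
  thus thesis using that[of w "content v"] cw v vw by auto
qed

definition poly_box :: "nat \<Rightarrow> int \<Rightarrow> int poly set" where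
  "poly_box n B = {p. (\<forall>i. \<bar>coeff p i\<bar> \<le> B) \<and> (\<forall>i\<ge>n. coeff p i = 0)}"

lemma finite_polys_bounded:
  fixes C :: "'a :: zero set"
  assumes "finite C"
  shows "finite {p. (\<forall>i<n. coeff p i \<in> C) \<and> (\<forall>i\<ge>n. coeff p i = 0)}" (is "finite ?A")
proof -
  have "inj_on (\<lambda>p. map (coeff p) [0..<n]) ?A"
  proof (rule inj_onI)
    fix p q assume *: "p \<in> ?A" "q \<in> ?A" "map (coeff p) [0..<n] = map (coeff q) [0..<n]"
    have "coeff p i = coeff q i" for i using * by (cases "i < n") auto
    thus "p = q" by (simp add: poly_eq_iff)
  qed
  moreover have "(\<lambda>p. map (coeff p) [0..<n]) ` ?A \<subseteq> {xs. set xs \<subseteq> C \<and> length xs = n}"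
    by auto
  moreover have "finite {xs. set xs \<subseteq> C \<and> length xs = n}"
    by (rule finite_lists_length_eq[OF assms])
  ultimately show ?thesis by (meson finite_imageD finite_subset)
qed

lemma finite_poly_box [simp]: "finite (poly_box n B)"
proof -
  have "poly_box n B \<subseteq> {p. (\<forall>i<n. coeff p i \<in> {-B..B}) \<and> (\<forall>i\<ge>n. coeff p i = 0)}"
    by (auto simp: poly_box_def abs_le_iff minus_le_iff)
  thus ?thesis by (rule finite_subset) (rule finite_polys_bounded, simp)
qed

text \<open>Modulo \<open>p\<close> the primitive \<open>v\<close> stays nonzero, and its leading
  coefficient there is invertible. Long division leaves remainders of bounded degree, with finitely
  many coefficients modulo \<open>p\<close>.\<close>

lemma prime_primitive_finite_residues:
  fixes v :: "int poly" and p :: int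
  assumes p: "prime p" and v: "content v = 1"
  shows "\<exists>R. finite R \<and> (\<forall>s. \<exists>r\<in>R. \<exists>a b. s = r + smult p a + v * b)"
proof -
  define S where "S = {i. \<not> p dvd coeff v i}"
  have "\<exists>i. \<not> p dvd coeff v i"
  proof (rule ccontr)
    assume "\<not> ?thesis"
    hence "p dvd content v" by (metis const_poly_dvd_iff const_poly_dvd_iff_dvd_content)
    thus False using v p not_prime_unit by metis
  qed
  hence "S \<noteq> {}" by (auto simp: S_def)
  moreover have "S \<subseteq> {..degree v}" unfolding S_def
    by (metis (mono_tags, lifting) atMost_iff dvd_0_right le_degree mem_Collect_eq subsetI)
  hence finS: "finite S" using finite_subset by blast
  ultimately have eS: "Max S \<in> S" by simp
  \<comment> \<open>\<open>e\<close> is the degree of \<open>v\<close> modulo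
    \<open>p\<close>.\<close>
  define e where "e = Max S"
  have e: "\<not> p dvd coeff v e" using eS by (simp add: S_def e_def)
  have above: "p dvd coeff v i" if "i > e" for i
    using that Max_ge[OF finS, of i] by (force simp: S_def e_def)
  have "coprime (coeff v e) p" using e p by (metis coprime_commute prime_imp_coprime)
  then obtain l l' where l: "l * coeff v e + l' * p = 1"
    using bezout_int[of "coeff v e" p] by auto
  define R where "R = {q. (\<forall>i<e. coeff q i \<in> {0..<p}) \<and> (\<forall>i\<ge>e. coeff q i = 0)}"
  have "\<exists>r a b. (\<forall>i\<ge>e. coeff r i = 0) \<and> s = r + smult p a + v * b"
    if "\<forall>i\<ge>e + m. coeff s i = 0" for m s
    using that
  proof (induction m arbitrary: s)
    case 0
    have "s = s + smult p 0 + v * 0" by simp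
    thus ?case using 0 by (metis add.right_neutral)
  next
    case (Suc m)
    define c where "c = coeff s (e + m)"
    \<comment> \<open>Since \<open>l\<close> inverts \<open>coeff v e\<close> modulo
      \<open>p\<close>, this makes the coefficient at \<open>e + m\<close> divisible by
      \<open>p\<close>; \<open>s2\<close> drops it together with everything above.\<close>
    define s1 where "s1 = s - monom (c * l) m * v"
    define s2 where "s2 = poly_cutoff (e + m) s1"
    have "p dvd coeff (s1 - s2) i" for i
    proof (cases "i < e + m")
      case True thus ?thesis by (simp add: s2_def coeff_poly_cutoff)
    next
      case False
      have "p dvd coeff s1 i"
      proof (cases "i = e + m")
        case True
        have "c - c * l * coeff v e = p * (c * l')" using l
          by (metis (no_types, opaque_lifting) add_diff_cancel_left' distrib_left mult.assoc mult.commute mult.right_neutral)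
        thus ?thesis using True by (simp add: s1_def coeff_monom_mult c_def)
      next
        case F: False
        hence "i > e + m" using False by simp
        thus ?thesis using Suc.prems above by (simp add: s1_def coeff_monom_mult)
      qed
      thus ?thesis using False by (simp add: s2_def coeff_poly_cutoff)
    qed
    hence "[:p:] dvd s1 - s2" by (simp add: const_poly_dvd_iff)
    then obtain a where "s1 - s2 = [:p:] * a" by (rule dvdE)
    hence a: "s1 - s2 = smult p a" by simp
    have "\<forall>i\<ge>e + m. coeff s2 i = 0" by (simp add: s2_def coeff_poly_cutoff)
    from Suc.IH[OF this] obtain r a' b' where r: "\<forall>i\<ge>e. coeff r i = 0" "s2 = r + smult p a' + v * b'"
      by blast
    have "s = s2 + (s1 - s2) + monom (c * l) m * v" by (simp add: s1_def)
    also have "\<dots> = r + smult p (a + a') + v * (b' + monom (c * l) m)"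
      unfolding a by (simp add: r(2) algebra_simps smult_add_right)
    finally have "s = r + smult p (a + a') + v * (b' + monom (c * l) m)" .
    thus ?case using r(1) by blast
  qed
  hence red: "\<exists>r a b. (\<forall>i\<ge>e. coeff r i = 0) \<and> s = r + smult p a + v * b" for s
    by (metis coeff_eq_0 le_add2 less_le_trans less_add_one add.commute Suc_eq_plus1 le_imp_less_Suc)
  have "\<exists>r\<in>R. \<exists>a b. s = r + smult p a + v * b" for s
  proof -
    obtain r a b where r: "\<forall>i\<ge>e. coeff r i = 0" "s = r + smult p a + v * b" using red by blast
    define r' where "r' = map_poly (\<lambda>x. x mod p) r"
    define r'' where "r'' = map_poly (\<lambda>x. x div p) r"
    have "r' \<in> R" using r p by (auto simp: R_def r'_def coeff_map_poly prime_gt_0_int)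
    moreover have "r = r' + smult p r''"
      by (rule poly_eqI) (simp add: r'_def r''_def coeff_map_poly)
    hence "s = r' + smult p (r'' + a) + v * b" using r(2) by (simp add: smult_add_right)
    ultimately show ?thesis by blast
  qed
  moreover have "finite R" unfolding R_def by (rule finite_polys_bounded) simp
  ultimately show ?thesis by blast
qed

text \<open>Mixed-radix digits: a residue modulo \<open>p * N\<close> is a residue modulo
  \<open>p\<close> plus \<open>p\<close> times one modulo \<open>N\<close>, which reduces everything
  to primes.\<close>

lemma primitive_finite_residues:
  fixes v :: "int poly" and N :: int
  assumes N: "N \<noteq> 0" and v: "content v = 1"
  shows "\<exists>R. finite R \<and> (\<forall>s. \<exists>r\<in>R. \<exists>a b. s = r + smult N a + v * b)"
  using N
proof (induction N rule: prime_divisors_induct)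
  case zero thus ?case by simp
next
  case (unit u)
  have "s = 0 + smult u (smult u s) + v * 0" for s
    using unit by (auto simp: zdvd1_eq abs_if split: if_splits)
  thus ?case by (intro exI[of _ "{0}"]) blast
next
  case (factor p N)
  then obtain R' where R': "finite R'" "\<And>s. \<exists>r\<in>R'. \<exists>a b. s = r + smult N a + v * b" by auto
  obtain R where R: "finite R" "\<And>s. \<exists>r\<in>R. \<exists>a b. s = r + smult p a + v * b"
    using prime_primitive_finite_residues[OF factor(1) v] by blast
  have "\<exists>r\<in>(\<lambda>(x, y). x + smult p y) ` (R \<times> R'). \<exists>a b. s = r + smult (p * N) a + v * b" for s
  proof -
    obtain r a b where 1: "r \<in> R" "s = r + smult p a + v * b" using R(2) by blast
    obtain r' a' b' where 2: "r' \<in> R'" "a = r' + smult N a' + v * b'" using R'(2) by blast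
    have "s = (r + smult p r') + smult (p * N) a' + v * (b + smult p b')"
      unfolding 1(2) 2(2) by (simp add: algebra_simps smult_add_right)
    thus ?thesis using 1(1) 2(1) by (intro bexI[of _ "r + smult p r'"]) auto
  qed
  thus ?case using R(1) R'(1) by (intro exI[of _ "(\<lambda>(x, y). x + smult p y) ` (R \<times> R')"]) auto
qed

text \<open>The least content \<open>c\<close> of a nonzero element \<open>v\<close> of
  \<open>I\<close> divides all of \<open>I\<close>. If \<open>c = 1\<close>, write
  \<open>v = w * v'\<close>. Then \<open>I\<close> contains \<open>w * v'\<close> and
  \<open>smult N w\<close>, and \<int>[t]/(N, v') is finite, so \<open>I\<close> has finite index in
  the multiples of \<open>w\<close>.\<close>

lemma poly_ideal_cases:
  assumes I: "poly_ideal I" and nz: "\<exists>p\<in>I. p \<noteq> 0"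
  shows "(\<exists>c\<ge>2. \<forall>q\<in>I. [:c:] dvd q) \<or>
    (\<exists>w R. content w = 1 \<and> finite R \<and> (\<forall>q\<in>I. w dvd q) \<and> (\<forall>s. \<exists>r\<in>R. w * (s - r) \<in> I))"
proof -
  obtain w N where w: "content w = 1" "N \<noteq> 0" "\<forall>q\<in>I. w dvd q" "smult N w \<in> I"
    using poly_ideal_gcd_exists[OF assms] by blast
  obtain v where v: "v \<in> I" "v \<noteq> 0"
    and min: "\<And>u. u \<in> I \<Longrightarrow> u \<noteq> 0 \<Longrightarrow> nat (content v) \<le> nat (content u)"
    using ex_has_least_nat[of "\<lambda>p. p \<in> I \<and> p \<noteq> 0" _ "\<lambda>p. nat (content p)"] nz by blast
  define c where "c = content v"
  have c0: "c > 0"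
    using v normalize_content[of v] unfolding c_def
    by (metis abs_ge_zero content_eq_zero_iff normalize_int_def order_le_less)
  have cdvd: "[:c:] dvd q" if q: "q \<in> I" for q
  proof -
    \<comment> \<open>shifting \<open>q\<close> beyond the degree of \<open>v\<close> keeps the two coefficient lists apart\<close>
    define u where "u = v + monom 1 (Suc (degree v)) * q"
    have uI: "u \<in> I" unfolding u_def using I v q by (simp add: poly_ideal_add poly_ideal_mult)
    have cv: "coeff u i = coeff v i" if "i \<le> degree v" for i
      using that by (simp add: u_def coeff_monom_mult)
    have cq: "coeff u (Suc (degree v) + i) = coeff q i" for i
      by (simp add: u_def coeff_monom_mult coeff_eq_0)
    have u0: "u \<noteq> 0" using cv[of "degree v"] v(2) by auto
    have "content u dvd coeff v i" for i
      using cv[of i] content_dvd_coeff[of u i]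
      by (cases "i \<le> degree v") (auto simp: coeff_eq_0)
    hence 1: "content u dvd c" unfolding c_def
      by (metis const_poly_dvd_iff const_poly_dvd_iff_dvd_content)
    have "content u dvd coeff q i" for i using cq[of i] content_dvd_coeff[of u] by metis
    hence 2: "[:content u:] dvd q" by (simp add: const_poly_dvd_iff)
    have "content u > 0" 
      using u0 by (metis abs_ge_zero content_eq_zero_iff normalize_content normalize_int_def order_le_less)
    hence "c \<le> content u" using min[OF uI u0] by (simp add: c_def)
    hence "content u = c" using zdvd_imp_le[OF 1 c0] by simp
    thus ?thesis using 2 by simp
  qed
  show ?thesis
  proof (cases "c \<ge> 2")
    case True thus ?thesis using cdvd by blast
  next
    case False
    hence c1: "content v = 1" using c0 by (simp add: c_def)
    obtain v' where v': "v = w * v'" using w(3) v(1) by (auto elim: dvdE)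
    have "content v' = 1" using c1 w(1) unfolding v' by (simp add: content_mult)
    from primitive_finite_residues[OF w(2) this] obtain R where
      R: "finite R" "\<And>s. \<exists>r\<in>R. \<exists>a b. s = r + smult N a + v' * b" by blast
    have "\<exists>r\<in>R. w * (s - r) \<in> I" for s
    proof -
      obtain r a b where r: "r \<in> R" "s = r + smult N a + v' * b" using R(2) by blast
      have "w * (s - r) = a * smult N w + b * v" unfolding r(2) v' by (simp add: algebra_simps)
      moreover have "a * smult N w + b * v \<in> I"
        using I w(4) v(1) by (intro poly_ideal_add poly_ideal_mult)
      ultimately show ?thesis using r(1) by metis
    qed
    thus ?thesis using w R(1) by blast
  qed
qed

text \<open>Division with remainder from the top down, except that a leading coefficient which is
  not a unit only allows each high coefficient to be reduced modulo it.\<close>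

lemma reduce_high_coeffs:
  fixes f p :: "int poly"
  assumes f: "f \<noteq> 0" and p: "\<forall>i\<ge>n. coeff p i = 0"
  shows "\<exists>q. f dvd p - q \<and> (\<forall>i\<ge>n. coeff q i = 0) \<and>
    (\<forall>i\<ge>degree f. coeff q i \<in> {0..<\<bar>lead_coeff f\<bar>})"
proof -
  let ?k = "degree f" and ?a = "lead_coeff f"
  \<comment> \<open>After \<open>j\<close> steps the positions from
    \<open>degree f + (n - j)\<close> on are reduced; for \<open>j = 0\<close> they hold
    zeros.\<close>
  have "\<exists>q. f dvd p - q \<and> (\<forall>i\<ge>n. coeff q i = 0) \<and> (\<forall>i\<ge>?k + (n - j). coeff q i \<in> {0..<\<bar>?a\<bar>})"
    if "j \<le> n" for j
    using that
  proof (induction j)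
    case 0
    show ?case using p f by (intro exI[of _ p]) auto
  next
    case (Suc j)
    then obtain q where q: "f dvd p - q" "\<forall>i\<ge>n. coeff q i = 0"
      "\<forall>i\<ge>?k + (n - j). coeff q i \<in> {0..<\<bar>?a\<bar>}" by auto
    define m where "m = n - Suc j"
    have nj: "n - j = Suc m" using Suc.prems by (simp add: m_def)
    define c where "c = coeff q (?k + m)"
    \<comment> \<open>The sign turns the factor \<open>lead_coeff f\<close> into its absolute value,
      so that \<open>c\<close> becomes its remainder.\<close>
    define q' where "q' = q - monom (sgn ?a * (c div \<bar>?a\<bar>)) m * f"
    have "p - q' = (p - q) + monom (sgn ?a * (c div \<bar>?a\<bar>)) m * f" by (simp add: q'_def)
    hence 1: "f dvd p - q'" using q(1) by (metis dvd_add dvd_triv_right)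
    have hi: "coeff q' i = coeff q i" if "i > ?k + m" for i
      using that by (simp add: q'_def coeff_monom_mult coeff_eq_0)
    have "sgn ?a * (c div \<bar>?a\<bar>) * ?a = c div \<bar>?a\<bar> * \<bar>?a\<bar>"
      by (metis abs_sgn mult.assoc mult.commute)
    moreover have "coeff q' (?k + m) = c - sgn ?a * (c div \<bar>?a\<bar>) * ?a"
      by (simp add: q'_def coeff_monom_mult c_def)
    ultimately have mid: "coeff q' (?k + m) = c mod \<bar>?a\<bar>"
      by (simp only: minus_div_mult_eq_mod)
    have 3: "\<forall>i\<ge>?k + m. coeff q' i \<in> {0..<\<bar>?a\<bar>}"
    proof safe
      fix i assume "i \<ge> ?k + m"
      show "coeff q' i \<in> {0..<\<bar>?a\<bar>}"
        using hi[of i] mid q(3) f \<open>i \<ge> ?k + m\<close> by (cases "i = ?k + m") (auto simp: nj)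
    qed
    \<comment> \<open>If the subtracted multiple of \<open>f\<close> could reach a position from
      \<open>n\<close> on, then \<open>c\<close> itself sits at such a position and is zero, so
      nothing is subtracted.\<close>
    have 2: "\<forall>i\<ge>n. coeff q' i = 0"
    proof safe
      fix i assume i: "i \<ge> n"
      show "coeff q' i = 0"
      proof (cases "i \<le> ?k + m")
        case True
        hence "c div \<bar>?a\<bar> = 0 \<or> i = ?k + m \<and> c = 0 \<or> i < ?k + m"
          using q(2) i by (auto simp: c_def)
        moreover have "c = 0" if "i \<le> ?k + m" using that i q(2) by (simp add: c_def)
        ultimately show ?thesis using q(2) i True by (simp add: q'_def coeff_monom_mult)
      next
        case False thus ?thesis using hi q(2) i by simp
      qed
    qed
    show ?case using 1 2 3 unfolding m_def by blast
  qed
  from this[of n] show ?thesis by simp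
qed

subsection \<open>Newton coordinates and counting residues from above\<close>

text \<open>The divided differences of \<open>p\<close> at the nodes, that is, its coordinates in
  the Newton basis 1, t - a1, (t - a1)(t - a2), and so on. Unlike the values at the nodes they also
  handle multiple roots.\<close>

primrec newton_coeffs :: "complex list \<Rightarrow> complex poly \<Rightarrow> complex list" where
  "newton_coeffs [] p = []"
| "newton_coeffs (a # as) p = poly p a # newton_coeffs as (synthetic_div p a)"

lemma synthetic_div_eqI:
  fixes p q :: "'a :: comm_ring_1 poly"
  assumes "p = [:-a, 1:] * q + [:r:]"
  shows "synthetic_div p a = q"
proof -
  have "p + smult a q = pCons r q" unfolding assms by (simp add: algebra_simps)
  thus ?thesis using synthetic_div_unique by blast
qed

lemma synthetic_div_diff:
  fixes p q :: "'a :: comm_ring_1 poly"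
  shows "synthetic_div (p - q) a = synthetic_div p a - synthetic_div q a"
proof (rule synthetic_div_eqI)
  have *: "(x * s + c) - (x * t + d) = x * (s - t) + (c - d)" for x s t c d :: "'a poly"
    by (simp add: algebra_simps)
  have "p - q = ([:-a, 1:] * synthetic_div p a + [:poly p a:]) - ([:-a, 1:] * synthetic_div q a + [:poly q a:])"
    by (simp only: synthetic_div_correct')
  thus "p - q = [:-a, 1:] * (synthetic_div p a - synthetic_div q a) + [:poly p a - poly q a:]"
    unfolding * by simp
qed

text \<open>Synthetic division at \<open>a\<close> strips the first factor of the product, so the
  coordinates depend only on the class modulo the product.\<close>

lemma newton_coeffs_add_multiple:
  "newton_coeffs as (p + (\<Prod>a\<leftarrow>as. [:-a, 1:]) * q) = newton_coeffs as p"
proof (induction as arbitrary: p)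
  case (Cons a as)
  let ?P = "\<Prod>a\<leftarrow>as. [:-a, 1:]"
  have "synthetic_div (p + ([:-a, 1:] * ?P) * q) a = synthetic_div p a + ?P * q"
  proof (rule synthetic_div_eqI)
    have "p + [:-a, 1:] * ?P * q = ([:-a, 1:] * synthetic_div p a + [:poly p a:]) + [:-a, 1:] * ?P * q"
      by (simp only: synthetic_div_correct')
    thus "p + [:-a, 1:] * ?P * q = [:-a, 1:] * (synthetic_div p a + ?P * q) + [:poly p a:]"
      by (simp only: algebra_simps)
  qed
  thus ?case using Cons.IH by simp
qed simp

text \<open>The identity \<open>p = [:-a, 1:] * s + [:poly p a:]\<close> recovers the coefficients
  of \<open>p\<close> from those of the quotient \<open>s\<close>. What matters is that
  \<open>K\<close> depends on the nodes alone.\<close>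

lemma coeff_bound_of_newton_coeffs:
  "\<exists>K>0. \<forall>p \<delta>. \<delta> \<ge> 0 \<longrightarrow> (\<forall>i\<ge>length as. coeff p i = 0) \<longrightarrow>
     (\<forall>x\<in>set (newton_coeffs as p). cmod x \<le> \<delta>) \<longrightarrow> (\<forall>i. cmod (coeff p i) \<le> K * \<delta>)"
proof (induction as)
  case Nil
  show ?case by (intro exI[of _ 1]) auto
next
  case (Cons a as)
  then obtain K where K: "K > 0" and bound: "\<And>p \<delta> i. \<delta> \<ge> 0 \<Longrightarrow> (\<forall>i\<ge>length as. coeff p i = 0) \<Longrightarrow>
     (\<forall>x\<in>set (newton_coeffs as p). cmod x \<le> \<delta>) \<Longrightarrow> cmod (coeff p i) \<le> K * \<delta>" by metis
  have "cmod (coeff p i) \<le> (1 + K + cmod a * K) * \<delta>"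
    if \<delta>: "\<delta> \<ge> 0" and z: "\<forall>i\<ge>length (a # as). coeff p i = 0"
      and n: "\<forall>x\<in>set (newton_coeffs (a # as) p). cmod x \<le> \<delta>" for p \<delta> i
  proof -
    define s where "s = synthetic_div p a"
    have p: "p = [:-a, 1:] * s + [:poly p a:]" by (simp only: s_def synthetic_div_correct')
    have deg: "degree p \<le> length as" using z by (intro degree_le) auto
    have "degree s = degree p - 1" by (simp add: s_def degree_synthetic_div)
    hence "coeff s i = 0" if "i \<ge> length as" for i
    proof (cases "degree p = 0")
      case True thus ?thesis using synthetic_div_eq_0_iff[of p a] by (simp add: s_def)
    next
      case False
      thus ?thesis using that deg \<open>degree s = _\<close> by (intro coeff_eq_0) auto
    qed
    hence s: "cmod (coeff s i) \<le> K * \<delta>" for i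
      using bound[OF \<delta>, of s] n by (auto simp: s_def)
    have pa: "cmod (poly p a) \<le> \<delta>" using n by simp
    have "coeff p i = (case i of 0 \<Rightarrow> poly p a | Suc j \<Rightarrow> coeff s j) - a * coeff s i"
      by (subst p) (simp split: nat.split)
    also have "cmod \<dots> \<le> (\<delta> + K * \<delta>) + cmod a * (K * \<delta>)"
    proof (rule order_trans[OF norm_triangle_ineq4 add_mono])
      show "cmod (case i of 0 \<Rightarrow> poly p a | Suc j \<Rightarrow> coeff s j) \<le> \<delta> + K * \<delta>"
        using pa s \<delta> K by (auto split: nat.split intro: order_trans add_increasing add_increasing2)
      show "cmod (a * coeff s i) \<le> cmod a * (K * \<delta>)"
        using s by (simp add: norm_mult mult_left_mono)
    qed
    finally show ?thesis by (simp add: algebra_simps)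
  qed
  moreover have "1 + K + cmod a * K > 0" using K by (simp add: add_pos_nonneg)
  ultimately show ?case by blast
qed

definition grid_cell :: "real \<Rightarrow> complex \<Rightarrow> int \<times> int" where
  "grid_cell \<delta> z = (\<lfloor>Re z / \<delta>\<rfloor>, \<lfloor>Im z / \<delta>\<rfloor>)"

lemma grid_cell_eqD:
  assumes "\<delta> > 0" "grid_cell \<delta> z = grid_cell \<delta> w"
  shows "cmod (z - w) \<le> 2 * \<delta>"
proof -
  have *: "\<bar>x - y\<bar> \<le> \<delta>" if "\<lfloor>x / \<delta>\<rfloor> = \<lfloor>y / \<delta>\<rfloor>" for x y
  proof -
    have "\<bar>x / \<delta> - y / \<delta>\<bar> \<le> 1" using that by linarith
    hence "\<bar>(x - y) / \<delta>\<bar> \<le> 1" by (simp add: diff_divide_distrib)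
    thus ?thesis using assms(1) by (simp add: field_simps)
  qed
  show ?thesis
    using cmod_le[of "z - w"] *[of "Re z" "Re w"] *[of "Im z" "Im w"] assms(2)
    by (auto simp: grid_cell_def)
qed

lemma grid_cells_disc:
  assumes "\<delta> > 0" "L \<ge> 0"
  shows "finite (grid_cell \<delta> ` {z. cmod z \<le> L})"
    and "real (card (grid_cell \<delta> ` {z. cmod z \<le> L})) \<le> (2 * L / \<delta> + 2)\<^sup>2"
proof -
  let ?I = "{\<lfloor>- L / \<delta>\<rfloor>..\<lfloor>L / \<delta>\<rfloor>}"
  have "\<lfloor>x / \<delta>\<rfloor> \<in> ?I" if "\<bar>x\<bar> \<le> L" for x
  proof -
    have "- L / \<delta> \<le> x / \<delta>" "x / \<delta> \<le> L / \<delta>"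
      using that assms by (auto intro: divide_right_mono simp only: abs_le_iff)
    thus ?thesis by (simp add: floor_mono)
  qed
  hence sub: "grid_cell \<delta> ` {z. cmod z \<le> L} \<subseteq> ?I \<times> ?I"
    using order_trans[OF abs_Re_le_cmod] order_trans[OF abs_Im_le_cmod] 
    by (force simp: grid_cell_def simp del: atLeastAtMost_iff)
  thus "finite (grid_cell \<delta> ` {z. cmod z \<le> L})" by (rule finite_subset) simp
  have le: "\<lfloor>- L / \<delta>\<rfloor> \<le> \<lfloor>L / \<delta>\<rfloor>" using assms by (intro floor_mono divide_right_mono) auto
  have "card (grid_cell \<delta> ` {z. cmod z \<le> L}) \<le> card (?I \<times> ?I)" by (rule card_mono[OF _ sub]) simp
  hence "real (card (grid_cell \<delta> ` {z. cmod z \<le> L})) \<le> real (card ?I) ^ 2"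
    by (simp add: power2_eq_square card_cartesian_product flip: of_nat_mult)
  moreover have "real (card ?I) \<le> 2 * L / \<delta> + 2"
    using le by simp linarith
  ultimately show "real (card (grid_cell \<delta> ` {z. cmod z \<le> L})) \<le> (2 * L / \<delta> + 2)\<^sup>2"
    by (meson of_nat_0_le_iff order_trans power_mono)
qed

definition newton_cells :: "real \<Rightarrow> complex list \<Rightarrow> complex poly \<Rightarrow> (int \<times> int) list" where
  "newton_cells \<delta> as p = map (grid_cell \<delta>) (newton_coeffs as p)"

lemma newton_cells_eqD:
  assumes "\<delta> > 0" "newton_cells \<delta> as p = newton_cells \<delta> as q"
  shows "\<forall>x\<in>set (newton_coeffs as (p - q)). cmod x \<le> 2 * \<delta>"
  using assms(2)
  by (induction as arbitrary: p q) (auto simp: newton_cells_def synthetic_div_diff grid_cell_eqD[OF assms(1)])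

text \<open>A quotient coefficient is the next coefficient of \<open>p\<close> plus \<open>a\<close>
  times the next one of the quotient; unrolling from the top gives at most \<open>n - i\<close>
  terms, each within \<open>C * m ^ (n - i)\<close>. The weights \<open>b ^ (n - i)\<close> describe
  coefficients after divisions at roots of modulus at most \<open>b\<close>, and they keep
  \<open>poly p a\<close> of order \<open>m ^ n\<close>.\<close>

lemma synthetic_div_coeff_bound:
  fixes p :: "complex poly"
  assumes z: "\<forall>i\<ge>n. coeff p i = 0" and c: "\<forall>i. cmod (coeff p i) \<le> C * b ^ (n - i)"
    and b: "1 \<le> b" "b \<le> m" "cmod a \<le> m" and C: "C \<ge> 0"
  shows "\<forall>i\<ge>n. coeff (synthetic_div p a) i = 0"
    and "cmod (coeff (synthetic_div p a) i) \<le> C * real (n + 1) * m ^ (n - i)"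
    and "cmod (poly p a) \<le> C * real (n + 1) * m ^ n"
proof -
  define s where "s = synthetic_div p a"
  have deg: "degree p \<le> n" using z by (intro degree_le) auto
  have ds: "degree s = degree p - 1" by (simp add: s_def degree_synthetic_div)
  show z': "\<forall>i\<ge>n. coeff (synthetic_div p a) i = 0"
  proof (cases "degree p = 0")
    case True
    hence "synthetic_div p a = 0" by (simp only: synthetic_div_eq_0_iff)
    thus ?thesis by simp
  next
    case False
    thus ?thesis using deg ds by (auto intro!: coeff_eq_0 simp: s_def)
  qed
  have p: "p = [:-a, 1:] * s + [:poly p a:]" by (simp only: s_def synthetic_div_correct')
  have rec: "coeff s i = coeff p (Suc i) + a * coeff s (Suc i)" for i
    by (subst p) simp
  have main: "cmod (coeff s (n - j)) \<le> C * real j * m ^ j" if "j \<le> n" for j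
    using that
  proof (induction j)
    case 0 thus ?case using z' by (simp add: s_def)
  next
    case (Suc j)
    have S: "Suc (n - Suc j) = n - j" using Suc.prems by simp
    have m: "m \<ge> 1" using b by simp
    have "cmod (coeff s (n - Suc j)) \<le> cmod (coeff p (n - j)) + cmod a * cmod (coeff s (n - j))"
      unfolding rec[of "n - Suc j"] S by (metis norm_mult norm_triangle_ineq)
    also have "\<dots> \<le> C * b ^ j + m * (C * real j * m ^ j)"
      using c[rule_format, of "n - j"] Suc b m by (intro add_mono mult_mono) (auto simp: diff_diff_cancel)
    also have "C * b ^ j \<le> C * m ^ Suc j"
      using b m C by (intro mult_left_mono order_trans[OF power_mono[of b m j] power_increasing]) auto
    finally show ?case by (simp add: algebra_simps)
  qed
  have m: "m \<ge> 1" using b by simp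
  show "cmod (coeff (synthetic_div p a) i) \<le> C * real (n + 1) * m ^ (n - i)"
  proof (cases "i \<le> n")
    case True
    hence "cmod (coeff s i) \<le> C * real (n - i) * m ^ (n - i)" using main[of "n - i"] by simp
    also have "\<dots> \<le> C * real (n + 1) * m ^ (n - i)"
      using C m by (intro mult_right_mono mult_left_mono) auto
    finally show ?thesis by (simp add: s_def)
  next
    case False
    thus ?thesis using z' C m by simp
  qed
  have "poly p a = (\<Sum>i<n. coeff p i * a ^ i)"
    unfolding poly_altdef using z
    by (intro sum.mono_neutral_cong) (auto simp: coeff_eq_0 not_less)
  also have "cmod \<dots> \<le> (\<Sum>i<n. C * m ^ n)"
  proof (rule sum_norm_le)
    fix i assume "i \<in> {..<n}"
    have "cmod (coeff p i * a ^ i) \<le> (C * m ^ (n - i)) * m ^ i"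
      unfolding norm_mult norm_power using b C
      by (intro mult_mono power_mono order_trans[OF c[rule_format]] mult_left_mono) auto
    also have "\<dots> = C * m ^ n" using \<open>i \<in> {..<n}\<close> by (simp flip: power_add)
    finally show "cmod (coeff p i * a ^ i) \<le> C * m ^ n" .
  qed
  also have "\<dots> \<le> C * real (n + 1) * m ^ n" using C m by (simp add: algebra_simps)
  finally show "cmod (poly p a) \<le> C * real (n + 1) * m ^ n" .
qed

text \<open>Sorting the roots by modulus is what keeps each Newton coefficient within the size
  permitted by its own root: the earlier synthetic divisions used only smaller roots.\<close>

lemma card_newton_cells:
  assumes "\<delta> > 0" "C \<ge> 0" "1 \<le> b" "sorted (map cmod as)" "\<forall>a\<in>set as. b \<le> max 1 (cmod a)"
    and X: "\<forall>p\<in>X. (\<forall>i\<ge>n. coeff p i = 0) \<and> (\<forall>i. cmod (coeff p i) \<le> C * b ^ (n - i))"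
  shows "finite (newton_cells \<delta> as ` X) \<and> real (card (newton_cells \<delta> as ` X)) \<le>
     (\<Prod>a\<leftarrow>as. 2 * (C * real (n + 1) ^ length as * max 1 (cmod a) ^ n) / \<delta> + 2)\<^sup>2"
  using assms(2-)
proof (induction as arbitrary: C b X)
  case Nil
  have "newton_cells \<delta> [] ` X \<subseteq> {[]}" by (auto simp: newton_cells_def)
  hence "finite (newton_cells \<delta> [] ` X)" "card (newton_cells \<delta> [] ` X) \<le> card {[] :: (int \<times> int) list}"
    by (auto intro: finite_subset card_mono simp del: card_insert_disjoint card.insert)
  thus ?case by simp
next
  case (Cons a as)
  define m where "m = max 1 (cmod a)"
  define C' where "C' = C * real (n + 1)"
  \<comment> \<open>The exponent counts all remaining nodes, so one \<open>D\<close> serves the head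
    and, through \<open>C'\<close>, the induction hypothesis for the tail.\<close>
  define D where "D = C * real (n + 1) ^ length (a # as)"
  define Y where "Y = (\<lambda>p. synthetic_div p a) ` X"
  have bm: "1 \<le> b" "b \<le> m" "cmod a \<le> m" using Cons.prems by (auto simp: m_def)
  have D: "D = C' * real (n + 1) ^ length as" by (simp add: D_def C'_def)
  have C': "C' \<ge> 0" using Cons.prems by (simp add: C'_def)
  have sb: "(\<forall>i\<ge>n. coeff (synthetic_div p a) i = 0) \<and>
      (\<forall>i. cmod (coeff (synthetic_div p a) i) \<le> C' * m ^ (n - i)) \<and> cmod (poly p a) \<le> C' * m ^ n"
    if "p \<in> X" for p
    using synthetic_div_coeff_bound[of n p C b m a] Cons.prems that bm unfolding C'_def by blast
  have IH: "finite (newton_cells \<delta> as ` Y) \<and> real (card (newton_cells \<delta> as ` Y)) \<le>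
     (\<Prod>a\<leftarrow>as. 2 * (D * max 1 (cmod a) ^ n) / \<delta> + 2)\<^sup>2"
    unfolding D
  proof (rule Cons.IH[of _ m])
    show "\<forall>x\<in>set as. m \<le> max 1 (cmod x)" using Cons.prems by (auto simp: m_def)
    show "\<forall>p\<in>Y. (\<forall>i\<ge>n. coeff p i = 0) \<and> (\<forall>i. cmod (coeff p i) \<le> C' * m ^ (n - i))"
      using sb by (auto simp: Y_def)
  qed (use Cons.prems bm C' in auto)
  have D0: "D \<ge> 0" using C' D by simp
  have m1: "m \<ge> 1" by (simp add: m_def)
  have "C' * 1 \<le> C' * real (n + 1) ^ length as" using C' by (intro mult_left_mono one_le_power) auto
  hence CD: "C' * m ^ n \<le> D * m ^ n" using m1 unfolding D by (intro mult_right_mono) auto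
  let ?G = "grid_cell \<delta> ` {z. cmod z \<le> D * m ^ n}"
  have Dm: "D * m ^ n \<ge> 0" using D0 m1 by simp
  have sub: "newton_cells \<delta> (a # as) ` X \<subseteq> (\<lambda>(x, xs). x # xs) ` (?G \<times> newton_cells \<delta> as ` Y)"
  proof safe
    fix p assume p: "p \<in> X"
    have "newton_cells \<delta> (a # as) p = (\<lambda>(x, xs). x # xs) (grid_cell \<delta> (poly p a), newton_cells \<delta> as (synthetic_div p a))"
      by (simp add: newton_cells_def)
    moreover have "grid_cell \<delta> (poly p a) \<in> ?G" using sb[OF p] CD by (intro imageI) simp
    moreover have "newton_cells \<delta> as (synthetic_div p a) \<in> newton_cells \<delta> as ` Y" using p by (simp add: Y_def)
    ultimately show "newton_cells \<delta> (a # as) p \<in> (\<lambda>(x, xs). x # xs) ` (?G \<times> newton_cells \<delta> as ` Y)"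
      by (metis (no_types, lifting) SigmaI image_eqI)
  qed
  have fin: "finite (?G \<times> newton_cells \<delta> as ` Y)" using IH grid_cells_disc[OF assms(1) Dm] by simp
  have "card (newton_cells \<delta> (a # as) ` X) \<le> card (?G \<times> newton_cells \<delta> as ` Y)"
    using card_mono[OF finite_imageI[OF fin] sub] card_image_le[OF fin] order_trans by blast
  hence "real (card (newton_cells \<delta> (a # as) ` X)) \<le> real (card ?G) * real (card (newton_cells \<delta> as ` Y))"
    by (metis card_cartesian_product of_nat_le_iff of_nat_mult)
  also have "\<dots> \<le> (2 * (D * m ^ n) / \<delta> + 2)\<^sup>2 * (\<Prod>a\<leftarrow>as. 2 * (D * max 1 (cmod a) ^ n) / \<delta> + 2)\<^sup>2"
    using IH grid_cells_disc[OF assms(1) Dm] by (intro mult_mono) auto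
  also have "\<dots> = (\<Prod>a\<leftarrow>a # as. 2 * (D * max 1 (cmod a) ^ n) / \<delta> + 2)\<^sup>2"
    by (simp add: m_def power_mult_distrib)
  finally show ?case using finite_subset[OF sub finite_imageI[OF fin]] unfolding D_def by blast
qed

abbreviation cpoly :: "int poly \<Rightarrow> complex poly" where
  "cpoly \<equiv> map_poly of_int"

text \<open>Provides the roots in the order that \<open>card_newton_cells\<close> requires, and the
  Mahler measure in multiplicative form.\<close>

lemma cpoly_factorization:
  assumes "f \<noteq> 0"
  obtains as where "cpoly f = smult (of_int (lead_coeff f)) (\<Prod>a\<leftarrow>as. [:-a, 1:])"
    "sorted (map cmod as)" "length as = degree f"
    "exp (log_mahler_measure f) = \<bar>real_of_int (lead_coeff f)\<bar> * (\<Prod>a\<leftarrow>as. max 1 (cmod a))"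
proof -
  obtain bs where bs: "mset bs = proots (cpoly f)" using ex_mset by blast
  define as where "as = sort_key cmod bs"
  have m: "mset as = proots (cpoly f)" using bs by (simp add: as_def)
  have lc: "lead_coeff (cpoly f) = of_int (lead_coeff f)" by (simp add: coeff_map_poly)
  have prod: "prod_list (map g as) = (\<Prod>x\<in>#proots (cpoly f). g x)" for g :: "complex \<Rightarrow> 'b :: comm_monoid_mult"
    by (simp add: m[symmetric] prod_mset_prod_list[symmetric])
  have 1: "cpoly f = smult (of_int (lead_coeff f)) (\<Prod>a\<leftarrow>as. [:-a, 1:])"
    using complex_poly_decompose_multiset[of "cpoly f"] by (simp only: lc prod)
  have 2: "length as = degree f"
    using size_proots_complex[of "cpoly f"] m[symmetric] by simp
  have ln: "(\<Sum>a\<in>#{#a \<in># A. cmod a > 1#}. ln (cmod a)) = ln (\<Prod>a\<in>#A. max 1 (cmod a))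
      \<and> (\<Prod>a\<in>#A. max 1 (cmod a)) > 0" for A
    by (induction A) (auto simp: ln_mult max_def not_le order_less_imp_le)
  have "log_mahler_measure f = ln \<bar>real_of_int (lead_coeff f)\<bar> + ln (\<Prod>a\<in>#proots (cpoly f). max 1 (cmod a))"
    using ln unfolding log_mahler_measure_def by simp
  hence "exp (log_mahler_measure f) = \<bar>real_of_int (lead_coeff f)\<bar> * (\<Prod>a\<in>#proots (cpoly f). max 1 (cmod a))"
    using ln[of "proots (cpoly f)"] assms by (simp add: exp_add)
  hence 3: "exp (log_mahler_measure f) = \<bar>real_of_int (lead_coeff f)\<bar> * (\<Prod>a\<leftarrow>as. max 1 (cmod a))"
    by (simp only: prod)
  show thesis using that[OF 1 _ 2 3] by (simp add: as_def)
qed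

lemma cpoly_dvd: "f dvd p \<Longrightarrow> cpoly f dvd cpoly p"
  by (metis dvdE dvd_triv_left of_int_poly_hom.hom_mult)

text \<open>Complex coordinates see a real lattice twice. Counting pairs \<open>(p, p')\<close> through the
  Gaussian combination \<open>p + i p'\<close> makes up for this without sorting the roots into conjugate pairs.\<close>

definition gauss_poly :: "int poly \<Rightarrow> int poly \<Rightarrow> complex poly" where
  "gauss_poly p p' = cpoly p + smult \<i> (cpoly p')"

lemma coeff_gauss_poly: "coeff (gauss_poly p p') i = Complex (of_int (coeff p i)) (of_int (coeff p' i))"
  by (simp add: gauss_poly_def complex_eq_iff coeff_map_poly)

lemma prod_list_map_mono:
  fixes g h :: "'a \<Rightarrow> real"
  assumes "\<And>x. x \<in> set xs \<Longrightarrow> 0 \<le> g x \<and> g x \<le> h x"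
  shows "0 \<le> (\<Prod>x\<leftarrow>xs. g x) \<and> (\<Prod>x\<leftarrow>xs. g x) \<le> (\<Prod>x\<leftarrow>xs. h x)"
  using assms
proof (induction xs)
  case (Cons x xs)
  have "0 \<le> g x \<and> g x \<le> h x" using Cons.prems by simp
  moreover have "0 \<le> (\<Prod>x\<leftarrow>xs. g x) \<and> (\<Prod>x\<leftarrow>xs. g x) \<le> (\<Prod>x\<leftarrow>xs. h x)"
    using Cons by simp
  ultimately show ?case by (auto intro: mult_mono)
qed simp

text \<open>A pair of representatives is coded by the high digits of its reductions modulo
  \<open>f\<close> and by the Newton cells of the unreduced \<open>gauss_poly\<close>, whose height
  is bounded. Reductions with equal codes agree from degree \<open>k\<close> on and have close
  Newton coordinates, so their integer coefficients differ by less than 1 and coincide.\<close>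

lemma card_residues_upper:
  fixes f :: "int poly" and ev :: "int poly \<Rightarrow> 'b" and B :: int
  assumes f: "f \<noteq> 0" and B: "B \<ge> 0" and ev: "\<And>p q. f dvd p - q \<Longrightarrow> ev p = ev q"
  shows "\<exists>K>0. \<exists>d. \<forall>n. real (card (ev ` poly_box n B)) \<le> K * real (n + 1) ^ d * exp (log_mahler_measure f) ^ n"
proof -
  obtain as where as: "cpoly f = smult (of_int (lead_coeff f)) (\<Prod>a\<leftarrow>as. [:-a, 1:])"
    "sorted (map cmod as)" "length as = degree f"
    and mahler: "exp (log_mahler_measure f) = \<bar>real_of_int (lead_coeff f)\<bar> * (\<Prod>a\<leftarrow>as. max 1 (cmod a))"
    by (rule cpoly_factorization[OF f])
  define k where "k = degree f"
  obtain K where K: "K > 0" and Kb: "\<And>p \<delta> i. \<delta> \<ge> 0 \<Longrightarrow> (\<forall>i\<ge>length as. coeff p i = 0) \<Longrightarrow>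
     (\<forall>x\<in>set (newton_coeffs as p). cmod x \<le> \<delta>) \<Longrightarrow> cmod (coeff p i) \<le> K * \<delta>"
    using coeff_bound_of_newton_coeffs[of as] by metis
  \<comment> \<open>Fine enough that Newton coordinates within \<open>2 * \<delta>\<close> force
    coefficients below 1, hence zero for integers.\<close>
  define \<delta> where "\<delta> = 1 / (4 * K)"
  have \<delta>: "\<delta> > 0" "K * (2 * \<delta>) < 1" using K by (auto simp: \<delta>_def)
  define C where "C = 2 * real_of_int B"
  have C: "C \<ge> 0" using B by (simp add: C_def)
  \<comment> \<open>\<open>E\<close> absorbs both summands of the bound in
    \<open>card_newton_cells\<close>, because \<open>real (n + 1) ^ k * max 1 (cmod a) ^ n\<close>
    is at least 1.\<close>
  define E where "E = 2 * C / \<delta> + 2"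
  have E: "E > 0" using C \<delta> by (simp add: E_def add_nonneg_pos)
  have newton_cong: "newton_coeffs as p = newton_coeffs as q" if "cpoly f dvd p - q" for p q
  proof -
    have "(\<Prod>a\<leftarrow>as. [:-a, 1:]) dvd p - q" using that f unfolding as(1) by (simp add: smult_dvd_iff)
    then obtain u where "p - q = (\<Prod>a\<leftarrow>as. [:-a, 1:]) * u" by (rule dvdE)
    hence "p = q + (\<Prod>a\<leftarrow>as. [:-a, 1:]) * u" by (simp add: diff_eq_eq add.commute)
    thus ?thesis by (simp only: newton_coeffs_add_multiple)
  qed
  have main: "real (card (ev ` poly_box n B)) \<le> E ^ k * real (n + 1) ^ (k * k) * exp (log_mahler_measure f) ^ n" for n
  proof -
    let ?box = "poly_box n B" and ?a = "\<bar>lead_coeff f\<bar>"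
    \<comment> \<open>\<open>S\<close> picks one polynomial of the box from each fibre of
      \<open>ev\<close>.\<close>
    obtain S where S: "S \<subseteq> ?box" "inj_on ev S" "ev ` ?box = ev ` S"
      using subset_image_inj[of "ev ` ?box" ev ?box] by auto
    have finS: "finite S" using finite_subset[OF S(1)] by simp
    have "\<exists>q. f dvd p - q \<and> (\<forall>i\<ge>n. coeff q i = 0) \<and> (\<forall>i\<ge>k. coeff q i \<in> {0..<?a})" if "p \<in> S" for p
      using reduce_high_coeffs[OF f, of n p] that S(1) by (auto simp: poly_box_def k_def)
    then obtain red where red: "\<And>p. p \<in> S \<Longrightarrow> f dvd p - red p"
      "\<And>p i. p \<in> S \<Longrightarrow> i \<ge> n \<Longrightarrow> coeff (red p) i = 0"
      "\<And>p i. p \<in> S \<Longrightarrow> i \<ge> k \<Longrightarrow> coeff (red p) i \<in> {0..<?a}" by metis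
    define \<rho> where "\<rho> p = map (coeff (red p)) [k..<n]" for p
    define A where "A = {xs. set xs \<subseteq> {0..<?a} \<and> length xs = n - k}"
    have A: "finite A" unfolding A_def by (rule finite_lists_length_eq) simp
    have "card A = nat ?a ^ (n - k)" unfolding A_def by (subst card_lists_length_eq) auto
    also have "\<dots> \<le> nat ?a ^ n"
    proof (intro power_increasing)
      have "lead_coeff f \<noteq> 0" using f by simp
      thus "1 \<le> nat ?a" by linarith
    qed simp
    finally have cardA: "real (card A) \<le> real_of_int ?a ^ n"
      by (metis abs_ge_zero of_nat_le_iff of_nat_nat of_nat_power)
    have \<rho>A: "\<rho> p \<in> A" if "p \<in> S" for p using red(3)[OF that] by (auto simp: \<rho>_def A_def)
    define X where "X = (\<lambda>(p, p'). gauss_poly p p') ` (S \<times> S)"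
    let ?cells = "newton_cells \<delta> as"
    have X: "finite (?cells ` X) \<and> real (card (?cells ` X)) \<le>
       (\<Prod>a\<leftarrow>as. 2 * (C * real (n + 1) ^ length as * max 1 (cmod a) ^ n) / \<delta> + 2)\<^sup>2"
    proof (rule card_newton_cells[where b = 1])
      show "\<forall>P\<in>X. (\<forall>i\<ge>n. coeff P i = 0) \<and> (\<forall>i. cmod (coeff P i) \<le> C * 1 ^ (n - i))"
      proof
        fix P assume "P \<in> X"
        then obtain p p' where P: "P = gauss_poly p p'" "p \<in> poly_box n B" "p' \<in> poly_box n B"
          using S(1) by (auto simp: X_def)
        have "cmod (coeff P i) \<le> C" for i
        proof -
          have "cmod (coeff P i) \<le> \<bar>real_of_int (coeff p i)\<bar> + \<bar>real_of_int (coeff p' i)\<bar>"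
            unfolding P(1) coeff_gauss_poly by (rule order_trans[OF cmod_le]) simp
          also have "\<dots> \<le> real_of_int B + real_of_int B"
            using P(2,3) by (intro add_mono) (auto simp: poly_box_def simp flip: of_int_abs)
          finally show ?thesis by (simp add: C_def)
        qed
        thus "(\<forall>i\<ge>n. coeff P i = 0) \<and> (\<forall>i. cmod (coeff P i) \<le> C * 1 ^ (n - i))"
          using P by (auto simp: coeff_gauss_poly poly_box_def complex_eq_iff)
      qed
    qed (use \<delta> C as in auto)
    define \<Psi> where "\<Psi> = (\<lambda>(p, p'). (\<rho> p, \<rho> p', ?cells (gauss_poly p p')))"
    have inj: "inj_on \<Psi> (S \<times> S)"
    proof (rule inj_onI, clarify)
      fix p p' q q' assume S': "p \<in> S" "p' \<in> S" "q \<in> S" "q' \<in> S" and eq: "\<Psi> (p, p') = \<Psi> (q, q')"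
      have low: "coeff (red u - red v) i = 0" if "i \<ge> k" "u \<in> S" "v \<in> S" "\<rho> u = \<rho> v" for u v i
      proof (cases "i < n")
        case True
        have "\<rho> u ! (i - k) = \<rho> v ! (i - k)" using that by simp
        thus ?thesis using True that(1) by (simp add: \<rho>_def)
      next
        case False thus ?thesis using red(2) that by simp
      qed
      let ?R = "gauss_poly (red p - red q) (red p' - red q')"
      \<comment> \<open>Congruence modulo \<open>f\<close> moves the estimate from the box, where
        the cells were recorded, to the difference of the reductions, which has no coefficients from
        \<open>k\<close> on.\<close>
      have "cpoly f dvd (cpoly (p - red p) - cpoly (q - red q)) +
           smult \<i> (cpoly (p' - red p') - cpoly (q' - red q'))"
        by (intro dvd_add dvd_diff dvd_smult cpoly_dvd red(1) S')
      also have "\<dots> = (gauss_poly p p' - gauss_poly q q') - ?R"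
        unfolding gauss_poly_def by (simp add: of_int_poly_hom.hom_minus algebra_simps smult_diff_right smult_add_right)
      finally have "newton_coeffs as (gauss_poly p p' - gauss_poly q q') = newton_coeffs as ?R"
        by (rule newton_cong)
      moreover have "\<forall>x\<in>set (newton_coeffs as (gauss_poly p p' - gauss_poly q q')). cmod x \<le> 2 * \<delta>"
        by (rule newton_cells_eqD[OF \<delta>(1)]) (use eq in \<open>simp add: \<Psi>_def\<close>)
      ultimately have "\<forall>x\<in>set (newton_coeffs as ?R). cmod x \<le> 2 * \<delta>" by simp
      moreover have "\<forall>i\<ge>length as. coeff ?R i = 0"
      proof safe
        fix i assume "i \<ge> length as"
        hence i: "i \<ge> k" by (simp add: as(3) k_def)
        have "\<rho> p = \<rho> q" "\<rho> p' = \<rho> q'" using eq by (simp_all add: \<Psi>_def)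
        thus "coeff ?R i = 0"
          unfolding coeff_gauss_poly using low[OF i] S' by (simp add: complex_eq_iff del: coeff_diff)
      qed
      ultimately have small: "cmod (coeff ?R i) < 1" for i
        using Kb[of "2 * \<delta>" ?R i] \<delta> by (meson less_eq_real_def mult_pos_pos le_less_trans zero_less_numeral)
      have "coeff (red p - red q) i = 0 \<and> coeff (red p' - red q') i = 0" for i
      proof -
        have "\<bar>real_of_int (coeff (red p - red q) i)\<bar> < 1" "\<bar>real_of_int (coeff (red p' - red q') i)\<bar> < 1"
          using le_less_trans[OF abs_Re_le_cmod small[of i]] le_less_trans[OF abs_Im_le_cmod small[of i]]
          unfolding coeff_gauss_poly by simp_all
        thus ?thesis by linarith
      qed
      hence "red p = red q" "red p' = red q'" by (auto simp: poly_eq_iff)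
      moreover have "ev u = ev (red u)" if "u \<in> S" for u using ev[OF red(1)[OF that]] .
      ultimately have "ev p = ev q" "ev p' = ev q'" using S' by metis+
      thus "p = q \<and> p' = q'" using S(2) S' by (auto dest: inj_onD)
    qed
    have "\<Psi> ` (S \<times> S) \<subseteq> A \<times> A \<times> ?cells ` X"
      using \<rho>A by (auto simp: \<Psi>_def X_def)
    moreover have "finite (A \<times> A \<times> ?cells ` X)" using A X by (intro finite_cartesian_product) auto
    ultimately have "card (S \<times> S) \<le> card (A \<times> A \<times> ?cells ` X)"
      using card_inj_on_le[OF inj] by metis
    hence "real (card (S \<times> S)) \<le> real (card (A \<times> A \<times> ?cells ` X))"
      by (simp only: of_nat_le_iff)
    hence "real (card S) ^ 2 \<le> real (card A) ^ 2 * real (card (?cells ` X))"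
      by (simp only: card_cartesian_product power2_eq_square of_nat_mult mult.assoc)
    also have "\<dots> \<le> (real_of_int ?a ^ n) ^ 2 * (\<Prod>a\<leftarrow>as. 2 * (C * real (n + 1) ^ length as * max 1 (cmod a) ^ n) / \<delta> + 2)\<^sup>2"
      using cardA X by (intro mult_mono power_mono) auto
    also have "\<dots> = (real_of_int ?a ^ n * (\<Prod>a\<leftarrow>as. 2 * (C * real (n + 1) ^ length as * max 1 (cmod a) ^ n) / \<delta> + 2))\<^sup>2"
      by (simp add: power_mult_distrib)
    \<comment> \<open>Pairs were counted, so both sides are squares and a square root gives the
      bound for \<open>S\<close>.\<close>
    finally have "real (card S) \<le> real_of_int ?a ^ n * (\<Prod>a\<leftarrow>as. 2 * (C * real (n + 1) ^ length as * max 1 (cmod a) ^ n) / \<delta> + 2)"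
    proof (rule power2_le_imp_le)
      show "0 \<le> real_of_int ?a ^ n * (\<Prod>a\<leftarrow>as. 2 * (C * real (n + 1) ^ length as * max 1 (cmod a) ^ n) / \<delta> + 2)"
        using C \<delta> by (intro mult_nonneg_nonneg prod_list_map_mono[THEN conjunct1] conjI[OF _ order_refl]
            add_nonneg_nonneg divide_nonneg_nonneg) auto
    qed
    also have "\<dots> \<le> real_of_int ?a ^ n * (\<Prod>a\<leftarrow>as. E * real (n + 1) ^ k * max 1 (cmod a) ^ n)"
    proof (intro mult_left_mono prod_list_map_mono[THEN conjunct2])
      fix a
      have "1 \<le> real (n + 1) ^ k * max 1 (cmod a) ^ n"
        using mult_mono[of 1 "real (n + 1) ^ k" 1 "max 1 (cmod a) ^ n"] by (simp add: one_le_power)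
      thus "0 \<le> 2 * (C * real (n + 1) ^ length as * max 1 (cmod a) ^ n) / \<delta> + 2 \<and>
          2 * (C * real (n + 1) ^ length as * max 1 (cmod a) ^ n) / \<delta> + 2 \<le> E * real (n + 1) ^ k * max 1 (cmod a) ^ n"
        using C \<delta> by (auto simp: E_def as(3) k_def algebra_simps intro!: add_nonneg_nonneg)
    qed simp
    also have "\<dots> = E ^ k * real (n + 1) ^ (k * k) * exp (log_mahler_measure f) ^ n"
    proof -
      have *: "(\<Prod>x\<leftarrow>xs. e * max 1 (cmod x) ^ n) = e ^ length xs * (\<Prod>x\<leftarrow>xs. max 1 (cmod x)) ^ n"
        for xs and e :: real
        by (induction xs) (auto simp: power_mult_distrib mult_ac)
      show ?thesis unfolding * by (simp add: mahler as(3) k_def power_mult_distrib power_mult mult_ac)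
    qed
    finally show ?thesis unfolding S(3) card_image[OF S(2)] .
  qed
  have "E ^ k > 0" using E by simp
  with main show ?thesis by blast
qed

subsection \<open>Counting residues from below\<close>

lemma poly_altdef_lessThan:
  fixes p :: "'a :: comm_semiring_1 poly"
  assumes "\<forall>i\<ge>n. coeff p i = 0"
  shows "poly p x = (\<Sum>i<n. coeff p i * x ^ i)"
  unfolding poly_altdef using assms
  by (intro sum.mono_neutral_cong) (auto simp: coeff_eq_0 not_less)

text \<open>A nonzero kernel vector would be the coefficient list of a polynomial of degree below
  \<open>n\<close> with \<open>n\<close> distinct roots.\<close>

lemma det_vandermonde_nonzero:
  fixes \<omega> :: "nat \<Rightarrow> complex"
  assumes "inj_on \<omega> {..<n}"
  shows "det (mat n n (\<lambda>(i, j). \<omega> i ^ j)) \<noteq> 0" (is "det ?W \<noteq> 0")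
proof
  assume "det ?W = 0"
  then obtain v where v: "v \<in> carrier_vec n" "v \<noteq> 0\<^sub>v n" "?W *\<^sub>v v = 0\<^sub>v n"
    using det_0_iff_vec_prod_zero[of ?W n] by auto
  define p where "p = (\<Sum>j<n. monom (v $ j) j)"
  have cp: "coeff p i = (if i < n then v $ i else 0)" for i
    by (simp add: p_def coeff_sum if_distrib sum.delta' cong: if_cong)
  have root: "poly p (\<omega> i) = 0" if "i < n" for i
  proof -
    have "poly p (\<omega> i) = (\<Sum>j<n. v $ j * \<omega> i ^ j)"
      by (subst poly_altdef_lessThan[of n]) (auto simp: cp)
    also have "\<dots> = (?W *\<^sub>v v) $ i"
      using that v(1) by (auto simp: scalar_prod_def lessThan_atLeast0 mult.commute intro!: sum.cong)
    finally show ?thesis using v(3) that by simp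
  qed
  have "p = 0"
  proof (cases "n = 0")
    case True thus ?thesis by (simp add: p_def)
  next
    case False
    have "degree p < n" using False cp by (intro degree_lessI) auto
    moreover have "card (\<omega> ` {..<n}) = n" using card_image[OF assms] by simp
    ultimately show ?thesis using root by (intro poly_eqI_degree[of "\<omega> ` {..<n}" p 0]) auto
  qed
  hence "v $ i = 0" if "i < n" for i using cp[of i] that by simp
  hence "v = 0\<^sub>v n" using v(1) by (intro eq_vecI) auto
  thus False using v(2) by simp
qed

text \<open>Evaluating the \<open>b j\<close> at the \<open>\<omega> i\<close> in two ways gives
  \<open>W * Bm = D * (W * Vm)\<close>. The Vandermonde determinant cancels and
  \<open>det Vm\<close> is a nonzero integer, so \<open>det D\<close> is at most the product of the
  diagonal of the triangular \<open>Bm\<close> in absolute value.\<close>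

lemma triangular_basis_norm:
  fixes b v :: "nat \<Rightarrow> int poly" and \<omega> :: "nat \<Rightarrow> complex"
  assumes inj: "inj_on \<omega> {..<n}"
    and b: "\<And>j i. j < n \<Longrightarrow> i > j \<Longrightarrow> coeff (b j) i = 0" "\<And>j. j < n \<Longrightarrow> coeff (b j) j \<noteq> 0"
    and v: "\<And>j i. j < n \<Longrightarrow> i \<ge> n \<Longrightarrow> coeff (v j) i = 0"
    and eq: "\<And>i j. i < n \<Longrightarrow> j < n \<Longrightarrow> poly (cpoly (b j)) (\<omega> i) = poly (cpoly g) (\<omega> i) * poly (cpoly (v j)) (\<omega> i)"
  shows "(\<Prod>i<n. cmod (poly (cpoly g) (\<omega> i))) \<le> (\<Prod>i<n. real_of_int \<bar>coeff (b i) i\<bar>)"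
proof -
  define W where "W = mat n n (\<lambda>(i, j). \<omega> i ^ j)"
  define Bm where "Bm = mat n n (\<lambda>(i, j). complex_of_int (coeff (b j) i))"
  define Vi where "Vi = mat n n (\<lambda>(i, j). coeff (v j) i)"
  define Vm where "Vm = map_mat complex_of_int Vi"
  define D where "D = mat n n (\<lambda>(i, j). if i = j then poly (cpoly g) (\<omega> i) else 0)"
  have carr: "W \<in> carrier_mat n n" "Bm \<in> carrier_mat n n" "Vm \<in> carrier_mat n n" "D \<in> carrier_mat n n"
    by (auto simp: W_def Bm_def Vm_def Vi_def D_def)
  have WB: "(W * Bm) $$ (i, j) = poly (cpoly (b j)) (\<omega> i)" if "i < n" "j < n" for i j
  proof -
    have "poly (cpoly (b j)) (\<omega> i) = (\<Sum>k<n. of_int (coeff (b j) k) * \<omega> i ^ k)"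
      using b(1)[OF that(2)] that by (subst poly_altdef_lessThan[of n]) (auto simp: coeff_map_poly)
    thus ?thesis using that
      by (auto simp: W_def Bm_def scalar_prod_def lessThan_atLeast0 mult.commute intro!: sum.cong)
  qed
  have WV: "(W * Vm) $$ (i, j) = poly (cpoly (v j)) (\<omega> i)" if "i < n" "j < n" for i j
  proof -
    have "poly (cpoly (v j)) (\<omega> i) = (\<Sum>k<n. of_int (coeff (v j) k) * \<omega> i ^ k)"
      using v[OF that(2)] that by (subst poly_altdef_lessThan[of n]) (auto simp: coeff_map_poly)
    thus ?thesis using that
      by (auto simp: W_def Vm_def Vi_def scalar_prod_def lessThan_atLeast0 mult.commute intro!: sum.cong)
  qed
  have "W * Bm = D * (W * Vm)"
  proof (rule eq_matI)
    fix i j assume "i < dim_row (D * (W * Vm))" "j < dim_col (D * (W * Vm))"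
    hence ij: "i < n" "j < n" using carr by auto
    have "(D * (W * Vm)) $$ (i, j) = (\<Sum>k<n. D $$ (i, k) * (W * Vm) $$ (k, j))"
      using ij carr by (auto simp: scalar_prod_def lessThan_atLeast0 intro!: sum.cong)
    also have "\<dots> = (\<Sum>k<n. if k = i then poly (cpoly g) (\<omega> i) * (W * Vm) $$ (i, j) else 0)"
      using ij by (intro sum.cong) (auto simp: D_def)
    also have "\<dots> = poly (cpoly g) (\<omega> i) * (W * Vm) $$ (i, j)"
      using ij by simp
    finally show "(W * Bm) $$ (i, j) = (D * (W * Vm)) $$ (i, j)"
      by (simp only: WB[OF ij] WV[OF ij] eq[OF ij])
  qed (use carr in auto)
  hence "det (W * Bm) = det (D * (W * Vm))" by simp
  hence "det W * det Bm = det D * (det W * det Vm)"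
    using carr by (simp add: det_mult[of _ n])
  moreover have "det W \<noteq> 0" unfolding W_def by (rule det_vandermonde_nonzero[OF inj])
  ultimately have det: "det Bm = det D * det Vm" by (simp add: mult.left_commute)
  have diag: "prod_list (diag_mat A) = (\<Prod>i<n. A $$ (i, i))" if "A \<in> carrier_mat n n" for A :: "complex mat"
    using that by (simp add: diag_mat_def prod.list_conv_set_nth lessThan_atLeast0)
  have "det Bm = (\<Prod>i<n. of_int (coeff (b i) i))"
    using det_upper_triangular[OF _ carr(2)] diag[OF carr(2)] b(1)
    by (auto simp: upper_triangular_def Bm_def)
  moreover have "det D = (\<Prod>i<n. poly (cpoly g) (\<omega> i))"
    using det_upper_triangular[OF _ carr(4)] diag[OF carr(4)]
    by (auto simp: upper_triangular_def D_def)
  moreover have dV: "det Vm = of_int (det Vi)" unfolding Vm_def by simp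
  ultimately have eq': "(\<Prod>i<n. of_int (coeff (b i) i)) = (\<Prod>i<n. poly (cpoly g) (\<omega> i)) * of_int (det Vi)"
    using det by simp
  have nz: "(\<Prod>i<n. complex_of_int (coeff (b i) i)) \<noteq> 0" using b(2) by simp
  hence "det Vi \<noteq> 0" using eq' by auto
  hence "1 \<le> \<bar>real_of_int (det Vi)\<bar>" by linarith
  hence "(\<Prod>i<n. cmod (poly (cpoly g) (\<omega> i))) * 1 \<le> (\<Prod>i<n. cmod (poly (cpoly g) (\<omega> i))) * \<bar>real_of_int (det Vi)\<bar>"
    by (intro mult_left_mono prod_nonneg) auto
  also have "\<dots> = cmod ((\<Prod>i<n. poly (cpoly g) (\<omega> i)) * of_int (det Vi))"
    by (simp add: norm_mult prod_norm)
  also have "\<dots> = (\<Prod>i<n. real_of_int \<bar>coeff (b i) i\<bar>)"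
    unfolding eq'[symmetric] by (simp flip: prod_norm)
  finally show ?thesis by simp
qed

text \<open>Both sides are values of monic polynomials of degree \<open>n\<close> that share
  \<open>n\<close> distinct roots.\<close>

lemma prod_linear_roots_of_two:
  assumes n: "n > 0" and \<omega>: "bij_betw \<omega> {..<n} {z :: complex. z ^ n = 2}"
  shows "(\<Prod>i<n. x - \<omega> i) = x ^ n - 2"
proof -
  define q where "q = (\<Prod>i<n. [:- \<omega> i, 1:])"
  have dq: "degree q = n" unfolding q_def by (subst degree_prod_sum_eq) auto
  have lq: "lead_coeff q = 1" unfolding q_def by (subst lead_coeff_prod) auto
  have "q = monom 1 n - [:2:]"
  proof (rule poly_eqI_degree_lead_coeff[of _ n _ "{z. z ^ n = 2}"])
    show "coeff q n = coeff (monom 1 n - [:2:]) n" using lq dq n by (simp add: coeff_pCons split: nat.split)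
    show "degree (monom 1 n - [:2:]) \<le> n" using n by (intro degree_le) (auto simp: coeff_pCons split: nat.split)
    fix z :: complex assume z: "z \<in> {z. z ^ n = 2}"
    then obtain i where "i < n" "z = \<omega> i" using \<omega> by (auto simp: bij_betw_def)
    hence "poly q z = 0" by (auto simp: q_def poly_prod)
    thus "poly q z = poly (monom 1 n - [:2:]) z" using z by (simp add: poly_monom)
  qed (use n dq in \<open>simp_all add: card_nth_roots\<close>)
  hence "poly q x = poly (monom 1 n - [:2:]) x" by simp
  thus ?thesis by (simp add: q_def poly_prod poly_monom)
qed

definition binom2 :: "nat \<Rightarrow> int poly" where
  "binom2 n = monom 1 n - [:2:]"

lemma coeff_binom2: "n > 0 \<Longrightarrow> coeff (binom2 n) i = (if i = n then 1 else if i = 0 then - 2 else 0)"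
  by (auto simp: binom2_def coeff_pCons split: nat.split)

lemma degree_binom2: "n > 0 \<Longrightarrow> degree (binom2 n) = n"
  by (intro antisym degree_le le_degree) (auto simp: coeff_binom2)

lemma lead_coeff_binom2: "n > 0 \<Longrightarrow> lead_coeff (binom2 n) = 1"
  by (simp add: degree_binom2 coeff_binom2)

lemma poly_binom2: "poly (cpoly (binom2 n)) z = z ^ n - 2"
  by (simp add: binom2_def of_int_poly_hom.hom_minus poly_monom)

text \<open>Reducing modulo the leading coefficient 1 leaves only zeros, so
  \<open>reduce_high_coeffs\<close> is ordinary division with remainder here.\<close>

lemma binom2_reduce:
  assumes "n > 0"
  shows "\<exists>v. binom2 n dvd u - v \<and> (\<forall>i\<ge>n. coeff v i = 0)"
proof -
  have "binom2 n \<noteq> 0" using lead_coeff_binom2[OF assms] by auto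
  moreover have "\<forall>i\<ge>Suc (degree u). coeff u i = 0" by (auto intro: coeff_eq_0)
  ultimately obtain q where "binom2 n dvd u - q" "\<forall>i\<ge>degree (binom2 n). coeff q i \<in> {0..<\<bar>lead_coeff (binom2 n)\<bar>}"
    using reduce_high_coeffs by blast
  moreover from this(2) have "coeff q i = 0" if "i \<ge> n" for i
    using that unfolding lead_coeff_binom2[OF assms] by (auto simp: degree_binom2[OF assms])
  ultimately show ?thesis by blast
qed

lemma binom2_residue_unique:
  assumes "n > 0" "binom2 n dvd u - v" "\<forall>i\<ge>n. coeff u i = 0" "\<forall>i\<ge>n. coeff v i = 0"
  shows "u = v"
proof (rule ccontr)
  assume "u \<noteq> v"
  hence "n \<le> degree (u - v)" using dvd_imp_degree_le[OF assms(2)] degree_binom2[OF assms(1)] by simp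
  hence "lead_coeff (u - v) = 0" unfolding coeff_diff using assms(3,4) by simp
  thus False using \<open>u \<noteq> v\<close> by (simp only: leading_coeff_0_iff right_minus_eq)
qed

text \<open>Modulo \<open>binom2 n\<close> the power \<open>t ^ n\<close> is 2, so the upper half of
  \<open>h\<close> returns doubled to the lower half. The explicit form serves to bound
  coefficients.\<close>

lemma binom2_fold:
  assumes "n > 0" "\<forall>i\<ge>2*n. coeff h i = 0"
  defines "r \<equiv> poly_cutoff n h + smult 2 (poly_shift n h)"
  shows "binom2 n dvd h - r" "\<forall>i\<ge>n. coeff r i = 0" "coeff r i = (if i < n then coeff h i else 0) + 2 * coeff h (i + n)"
proof -
  show c: "coeff r i = (if i < n then coeff h i else 0) + 2 * coeff h (i + n)" for i
    by (simp add: r_def coeff_poly_cutoff coeff_poly_shift add.commute)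
  show "\<forall>i\<ge>n. coeff r i = 0" using assms(2) c by simp
  have "h - r = binom2 n * poly_shift n h"
  proof (rule poly_eqI)
    fix i
    show "coeff (h - r) i = coeff (binom2 n * poly_shift n h) i"
      by (auto simp: c binom2_def algebra_simps coeff_monom_mult coeff_poly_shift)
  qed
  thus "binom2 n dvd h - r" by simp
qed

definition coeff_norm1 :: "int poly \<Rightarrow> int" where
  "coeff_norm1 g = (\<Sum>i\<le>degree g. \<bar>coeff g i\<bar>)"

lemma coeff_mult_bound:
  fixes g z :: "int poly"
  assumes "\<And>i. \<bar>coeff z i\<bar> \<le> N"
  shows "\<bar>coeff (z * g) i\<bar> \<le> N * coeff_norm1 g"
proof -
  have N: "N \<ge> 0" using assms[of 0] by linarith
  have "coeff (z * g) i = (\<Sum>j\<le>i. coeff g j * coeff z (i - j))"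
    by (subst mult.commute) (rule coeff_mult)
  also have "\<bar>\<dots>\<bar> \<le> (\<Sum>j\<le>i. \<bar>coeff g j\<bar> * N)"
    by (rule order_trans[OF sum_abs sum_mono]) (simp add: abs_mult assms mult_left_mono)
  also have "\<dots> = (\<Sum>j\<in>{..i} \<inter> {..degree g}. \<bar>coeff g j\<bar> * N)"
    by (rule sum.mono_neutral_right) (auto intro: le_degree)
  also have "\<dots> \<le> (\<Sum>j\<le>degree g. \<bar>coeff g j\<bar> * N)"
    using N by (intro sum_mono2) auto
  also have "\<dots> = N * coeff_norm1 g"
    by (simp add: coeff_norm1_def sum_distrib_left mult.commute)
  finally show ?thesis .
qed

definition ideal2 :: "int poly \<Rightarrow> int poly \<Rightarrow> int poly set" where
  "ideal2 f g = {u * f + w * g | u w. True}"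

lemma poly_ideal_ideal2: "poly_ideal (ideal2 f g)"
  unfolding poly_ideal_def
proof safe
  show "0 \<in> ideal2 f g" unfolding ideal2_def by (intro CollectI exI[of _ 0]) simp
next
  fix p q assume "p \<in> ideal2 f g" "q \<in> ideal2 f g"
  then obtain a b c d where "p = a * f + b * g" "q = c * f + d * g" by (auto simp: ideal2_def)
  hence "p + q = (a + c) * f + (b + d) * g" by (simp add: algebra_simps)
  thus "p + q \<in> ideal2 f g" unfolding ideal2_def by blast
next
  fix p r assume "p \<in> ideal2 f g"
  then obtain a b where "p = a * f + b * g" by (auto simp: ideal2_def)
  hence "r * p = (r * a) * f + (r * b) * g" by (simp add: algebra_simps)
  thus "r * p \<in> ideal2 f g" unfolding ideal2_def by blast
qed

lemma ideal2_multiple: "f dvd p \<Longrightarrow> p \<in> ideal2 f g" "g dvd p \<Longrightarrow> p \<in> ideal2 f g"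
proof -
  assume "f dvd p"
  then obtain u where "p = u * f + 0 * g" by (auto simp: dvd_def mult.commute)
  thus "p \<in> ideal2 f g" unfolding ideal2_def by blast
next
  assume "g dvd p"
  then obtain u where "p = 0 * f + u * g" by (auto simp: dvd_def mult.commute)
  thus "p \<in> ideal2 f g" unfolding ideal2_def by blast
qed

text \<open>The primitive generator \<open>w\<close> over the rationals divides both polynomials; a
  nonconstant one would have a complex root in common with them. So \<open>w\<close> is a unit, and
  an integer multiple of it lies in the ideal.\<close>

lemma coprime_ideal2_const:
  assumes f: "f \<noteq> 0" and nr: "\<And>z. poly (cpoly f) z = 0 \<Longrightarrow> poly (cpoly g) z \<noteq> 0"
  shows "\<exists>N>0. [:N:] \<in> ideal2 f g"
proof -
  have "f \<in> ideal2 f g" "g \<in> ideal2 f g" by (auto intro: ideal2_multiple)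
  then obtain w N where w: "content w = 1" "N \<noteq> 0" "\<forall>q\<in>ideal2 f g. w dvd q" "smult N w \<in> ideal2 f g"
    using poly_ideal_gcd_exists[OF poly_ideal_ideal2] f by blast
  have wd: "w dvd f" "w dvd g" using w(3) \<open>f \<in> _\<close> \<open>g \<in> _\<close> by auto
  have "degree w = 0"
  proof (rule ccontr)
    assume "degree w \<noteq> 0"
    hence "\<not> constant (poly (cpoly w))" by (simp add: constant_degree)
    then obtain z where "poly (cpoly w) z = 0" using fundamental_theorem_of_algebra by blast
    hence "poly (cpoly f) z = 0" "poly (cpoly g) z = 0"
      using wd[THEN cpoly_dvd] by (auto simp: dvd_def)
    thus False using nr by blast
  qed
  then obtain c where c: "w = [:c:]" by (auto elim: degree_eq_zeroE)
  hence "\<bar>c\<bar> = 1" using w(1) by simp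
  have "[:N * c:] \<in> ideal2 f g" using w(4) c by simp
  moreover from poly_ideal_smult[OF poly_ideal_ideal2 this, of "-1"] have "[:- (N * c):] \<in> ideal2 f g" by simp
  moreover have "N * c \<noteq> 0" using w(2) \<open>\<bar>c\<bar> = 1\<close> by auto
  ultimately show ?thesis by (metis neg_0_less_iff_less linorder_neqE_linordered_idom)
qed

text \<open>Every class modulo \<open>(g, t\<^sup>n - 2)\<close> meets the fundamental parallelepiped spanned by the
  \<open>t\<^sup>i g\<close>, whose integer points have coefficients bounded independently of \<open>n\<close>.\<close>

lemma small_representative:
  assumes n: "n > 0" "degree g \<le> n" and N: "N > 0" "[:N:] \<in> ideal2 g (binom2 n)"
  shows "\<exists>r\<in>poly_box n (3 * coeff_norm1 g). p - r \<in> ideal2 g (binom2 n)"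
proof -
  let ?P = "binom2 n"
  obtain u w where uw: "[:N:] = u * g + w * ?P" using N(2) by (auto simp: ideal2_def)
  \<comment> \<open>Modulo \<open>?P\<close> the integer \<open>N\<close> is \<open>u * g\<close>,
    so \<open>N * p\<close> is \<open>y * g\<close> there, and \<open>y / N\<close> holds the
    coordinates of \<open>p\<close> in the \<open>t ^ i * g\<close>. Below, \<open>v\<close> is
    their integer part and \<open>z / N\<close> the fractional part.\<close>
  obtain y where y: "?P dvd p * u - y" "\<forall>i\<ge>n. coeff y i = 0" using binom2_reduce[OF n(1)] by blast
  define z where "z = map_poly (\<lambda>x. x mod N) y"
  define v where "v = map_poly (\<lambda>x. x div N) y"
  have yzv: "y = smult N v + z" by (rule poly_eqI) (simp add: z_def v_def coeff_map_poly)
  obtain r where r: "?P dvd (p - v * g) - r" "\<forall>i\<ge>n. coeff r i = 0" using binom2_reduce[OF n(1)] by blast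
  have zb: "\<bar>coeff z i\<bar> \<le> N" for i using N(1) by (simp add: z_def coeff_map_poly less_imp_le)
  have z0: "coeff z i = 0" if "i \<ge> n" for i using y(2) that by (simp add: z_def coeff_map_poly)
  have zg: "\<forall>i\<ge>2*n. coeff (z * g) i = 0"
  proof safe
    fix i assume i: "i \<ge> 2 * n"
    have "degree z < n" using z0 n(1) by (intro degree_lessI) auto
    hence "degree (z * g) < i" using degree_mult_le[of z g] n(2) i by linarith
    thus "coeff (z * g) i = 0" by (rule coeff_eq_0)
  qed
  define q where "q = poly_cutoff n (z * g) + smult 2 (poly_shift n (z * g))"
  note q = binom2_fold[OF n(1) zg, folded q_def]
  \<comment> \<open>\<open>smult N r\<close> and the folded \<open>z * g\<close> are congruent
    modulo \<open>?P\<close> and have no coefficients from \<open>n\<close> on, so they are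
    equal.\<close>
  have "smult N r - q = (z * g - q) - smult N ((p - v * g) - r) + (p * ([:N:] - u * g)) + (p * u - y) * g"
    unfolding yzv by (simp add: algebra_simps smult_add_right smult_diff_right)
  also have "?P dvd \<dots>" using q(1) r(1) y(1) unfolding uw
    by (intro dvd_add dvd_diff[of _ "z * g - q"] dvd_smult[of _ "p - v * g - r"] dvd_mult2[of _ "p * u - y"]) auto
  finally have "smult N r = q" using binom2_residue_unique[OF n(1)] q(2) r(2) by simp
  have "\<bar>coeff r i\<bar> \<le> 3 * coeff_norm1 g" for i
  proof -
    have "N * \<bar>coeff r i\<bar> = \<bar>coeff q i\<bar>" using N(1) by (simp flip: \<open>smult N r = q\<close> add: abs_mult)
    also have "\<dots> \<le> \<bar>coeff (z * g) i\<bar> + 2 * \<bar>coeff (z * g) (i + n)\<bar>" unfolding q(3)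
      using abs_triangle_ineq[of "coeff (z * g) i" "2 * coeff (z * g) (i + n)"] by (simp add: abs_mult)
    \<comment> \<open>The factor 3 is one copy from the lower half and two from the folded upper
      half.\<close>
    also have "\<dots> \<le> N * (3 * coeff_norm1 g)"
      using coeff_mult_bound[OF zb, of g i] coeff_mult_bound[OF zb, of g "i + n"] by simp
    finally show ?thesis using N(1) by simp
  qed
  hence "r \<in> poly_box n (3 * coeff_norm1 g)" using r(2) by (simp add: poly_box_def)
  moreover have "v * g + ((p - v * g) - r) \<in> ideal2 g ?P"
    using r(1) by (intro poly_ideal_add[OF poly_ideal_ideal2] ideal2_multiple(1)[of g "v * g"] ideal2_multiple(2)) auto
  hence "p - r \<in> ideal2 g ?P" by (simp add: algebra_simps)
  ultimately show ?thesis by blast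
qed

text \<open>In each degree take an element of \<open>I\<close> with least positive leading
  coefficient; \<open>monom N i\<close> shows that one exists. Minimality makes distinct polynomials
  with digits below these coefficients incongruent modulo \<open>I\<close>.\<close>

lemma ideal_triangular_basis:
  assumes I: "poly_ideal I" and N: "N > 0" "[:N:] \<in> I"
  obtains b :: "nat \<Rightarrow> int poly" where "\<And>i. b i \<in> I" "\<And>i. degree (b i) = i" "\<And>i. lead_coeff (b i) > 0"
    "\<And>p. p \<in> I \<Longrightarrow> p \<noteq> 0 \<Longrightarrow> lead_coeff (b (degree p)) \<le> \<bar>lead_coeff p\<bar>"
proof -
  have "\<exists>b. b \<in> I \<and> degree b = i \<and> lead_coeff b > 0 \<and>
      (\<forall>p. p \<in> I \<and> degree p = i \<and> lead_coeff p > 0 \<longrightarrow> lead_coeff b \<le> lead_coeff p)" for i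
  proof -
    have "monom 1 i * [:N:] \<in> I" using I N by (simp only: poly_ideal_mult)
    hence "monom N i \<in> I" by (simp add: smult_monom)
    hence "\<exists>b. b \<in> I \<and> degree b = i \<and> lead_coeff b > 0"
      using N(1) by (intro exI[of _ "monom N i"]) (simp add: degree_monom_eq)
    then obtain b where b: "b \<in> I \<and> degree b = i \<and> lead_coeff b > 0" "\<And>p. p \<in> I \<and> degree p = i \<and> lead_coeff p > 0 \<Longrightarrow>
        nat (lead_coeff b) \<le> nat (lead_coeff p)"
      using ex_has_least_nat[of "\<lambda>b. b \<in> I \<and> degree b = i \<and> lead_coeff b > 0" _ "\<lambda>b. nat (lead_coeff b)"] by blast
    have "lead_coeff b \<le> lead_coeff p" if "p \<in> I \<and> degree p = i \<and> lead_coeff p > 0" for p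
      using b(2)[OF that] that by linarith
    thus ?thesis using b(1) by blast
  qed
  then obtain b where b: "\<And>i. b i \<in> I" "\<And>i. degree (b i) = i" "\<And>i. lead_coeff (b i) > 0"
    "\<And>i p. p \<in> I \<Longrightarrow> degree p = i \<Longrightarrow> lead_coeff p > 0 \<Longrightarrow> lead_coeff (b i) \<le> lead_coeff p" by metis
  have "lead_coeff (b (degree p)) \<le> \<bar>lead_coeff p\<bar>" if p: "p \<in> I" "p \<noteq> 0" for p
  proof (cases "lead_coeff p > 0")
    case True thus ?thesis using b(4)[OF p(1)] by simp
  next
    case False
    hence "lead_coeff (- p) > 0" using p(2) by (simp add: less_le)
    moreover have "- p \<in> I" using poly_ideal_smult[OF I p(1), of "-1"] by simp
    ultimately show ?thesis using b(4)[of "- p"] by simp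
  qed
  thus thesis using that b by blast
qed

text \<open>With \<open>d i\<close> the leading coefficients of a triangular basis of
  \<open>?L\<close>, there are at least as many classes modulo \<open>?L\<close> as the product of
  the \<open>d i\<close>, and each meets the box. Polynomials identified by \<open>ev\<close> agree
  modulo \<open>g\<close>, so \<open>ev\<close> takes at least that many values.\<close>

lemma card_residues_ge_norm:
  fixes ev :: "int poly \<Rightarrow> 'b"
  assumes n: "n > 0" "degree g \<le> n" and g: "g \<noteq> 0"
    and nr: "\<And>z. poly (cpoly g) z = 0 \<Longrightarrow> z ^ n \<noteq> 2"
    and ev: "\<And>p q. ev p = ev q \<Longrightarrow> g dvd p - q"
    and \<omega>: "bij_betw \<omega> {..<n} {z :: complex. z ^ n = 2}"
  shows "(\<Prod>i<n. cmod (poly (cpoly g) (\<omega> i))) \<le> real (card (ev ` poly_box n (3 * coeff_norm1 g)))"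
proof -
  let ?P = "binom2 n" and ?box = "poly_box n (3 * coeff_norm1 g)"
  let ?L = "ideal2 g ?P"
  obtain N where N: "N > 0" "[:N:] \<in> ?L"
    using coprime_ideal2_const[OF g, of ?P] nr by (auto simp: poly_binom2)
  obtain b where b: "\<And>i. b i \<in> ?L" "\<And>i. degree (b i) = i" "\<And>i. lead_coeff (b i) > 0"
    "\<And>p. p \<in> ?L \<Longrightarrow> p \<noteq> 0 \<Longrightarrow> lead_coeff (b (degree p)) \<le> \<bar>lead_coeff p\<bar>"
    by (rule ideal_triangular_basis[OF poly_ideal_ideal2 N]) (rule that)
  define d where "d i = coeff (b i) i" for i
  have d: "d i > 0" for i using b(2,3)[of i] by (simp add: d_def)
  \<comment> \<open>On the roots of \<open>?P\<close> the basis element is \<open>g\<close> times a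
    polynomial without coefficients from \<open>n\<close> on, as
    \<open>triangular_basis_norm\<close> requires.\<close>
  have "\<exists>v. (\<forall>i\<ge>n. coeff v i = 0) \<and>
      (\<forall>z. z ^ n = 2 \<longrightarrow> poly (cpoly (b j)) z = poly (cpoly g) z * poly (cpoly v) z)" for j
  proof -
    obtain u w where uw: "b j = u * g + w * ?P" using b(1)[of j] by (auto simp: ideal2_def)
    obtain v where v: "?P dvd u - v" "\<forall>i\<ge>n. coeff v i = 0" using binom2_reduce[OF n(1)] by blast
    obtain s where s: "u - v = ?P * s" using v(1) by (rule dvdE)
    have u: "u = v + ?P * s" using s by (simp add: diff_eq_eq add.commute)
    have "poly (cpoly (b j)) z = poly (cpoly g) z * poly (cpoly v) z" if "z ^ n = 2" for z
      unfolding uw u of_int_poly_hom.hom_add of_int_poly_hom.hom_mult poly_add poly_mult poly_binom2 that by simp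
    thus ?thesis using v(2) by blast
  qed
  then obtain v where v: "\<And>j i. i \<ge> n \<Longrightarrow> coeff (v j) i = 0"
    "\<And>j z. z ^ n = 2 \<Longrightarrow> poly (cpoly (b j)) z = poly (cpoly g) z * poly (cpoly (v j)) z" by metis
  have \<omega>2: "\<omega> i ^ n = 2" if "i < n" for i using \<omega> that by (auto simp: bij_betw_def)
  have "(\<Prod>i<n. cmod (poly (cpoly g) (\<omega> i))) \<le> (\<Prod>i<n. real_of_int \<bar>coeff (b i) i\<bar>)"
  proof (rule triangular_basis_norm[where v = v])
    show "inj_on \<omega> {..<n}" using \<omega> by (simp add: bij_betw_def)
    show "coeff (b j) i = 0" if "i > j" for i j using that b(2) by (intro coeff_eq_0) simp
    show "coeff (b j) j \<noteq> 0" for j using d[of j] by (simp add: d_def)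
  qed (use v \<omega>2 in auto)
  also have "(\<Prod>i<n. real_of_int \<bar>coeff (b i) i\<bar>) = real (\<Prod>i<n. nat (d i))"
    unfolding of_nat_prod by (intro prod.cong refl) (use d in \<open>simp add: d_def[symmetric] order_less_imp_le abs_of_pos\<close>)
  also have "(\<Prod>i<n. nat (d i)) \<le> card (ev ` ?box)"
  proof -
    define D where "D = PiE {..<n} (\<lambda>i. {0..<d i})"
    define pl where "pl x = (\<Sum>i<n. monom (x i) i)" for x :: "nat \<Rightarrow> int"
    have cpl: "coeff (pl x) i = (if i < n then x i else 0)" for x i
      by (simp add: pl_def coeff_sum if_distrib sum.delta' cong: if_cong)
    have "card D = (\<Prod>i<n. nat (d i))" by (simp add: D_def card_PiE)
    moreover obtain r where r: "\<And>p. r p \<in> ?box" "\<And>p. p - r p \<in> ?L"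
      using small_representative[OF n N] by metis
    have "inj_on (\<lambda>x. ev (r (pl x))) D"
    proof (rule inj_onI)
      fix x y assume xy: "x \<in> D" "y \<in> D" "ev (r (pl x)) = ev (r (pl y))"
      have "pl x - pl y = (pl x - r (pl x)) - (pl y - r (pl y)) + (r (pl x) - r (pl y))" by simp
      also have "\<dots> \<in> ?L"
        by (intro poly_ideal_add[OF poly_ideal_ideal2] poly_ideal_diff[OF poly_ideal_ideal2] r
            ideal2_multiple(1) ev xy(3))
      finally have L: "pl x - pl y \<in> ?L" .
      have "pl x = pl y"
      proof (rule ccontr)
        assume "pl x \<noteq> pl y"
        hence nz: "pl x - pl y \<noteq> 0" by simp
        define i where "i = degree (pl x - pl y)"
        have ci: "coeff (pl x - pl y) i \<noteq> 0" using nz unfolding i_def by (simp only: leading_coeff_0_iff not_False_eq_True)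
        hence i: "i < n" by (auto simp: cpl split: if_splits)
        \<comment> \<open>A nonzero element of \<open>?L\<close> of degree \<open>i\<close> has
          leading coefficient of size at least \<open>d i\<close>, but two digits below
          \<open>d i\<close> differ by less.\<close>
        have "0 \<le> x i" "x i < d i" "0 \<le> y i" "y i < d i" using xy(1,2) i by (auto simp: D_def PiE_iff)
        moreover have "d i \<le> \<bar>x i - y i\<bar>" using b(4)[OF L nz] b(2)[of i] i
          by (simp add: d_def cpl flip: i_def)
        ultimately show False by linarith
      qed
      hence "x i = y i" if "i < n" for i using cpl[of x i] cpl[of y i] that by simp
      thus "x = y" using xy(1,2) unfolding D_def by (intro PiE_ext) auto
    qed
    hence "card D \<le> card (ev ` ?box)" by (rule card_inj_on_le) (use r in auto)
    ultimately show ?thesis by simp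
  qed
  finally show ?thesis by simp
qed

text \<open>If \<open>cmod a \<le> 1\<close>, the distance of \<open>a ^ n\<close> from 2 is at
  least 1, even on the unit circle. Otherwise 2 is at most half of \<open>cmod a ^ n\<close> once
  the latter reaches 4.\<close>

lemma eventually_abs_power_minus_two:
  "\<forall>\<^sub>F n in sequentially. max 1 (cmod a) ^ n / 2 \<le> cmod (a ^ n - 2)"
proof (cases "cmod a \<le> 1")
  case True
  have "max 1 (cmod a) ^ n / 2 \<le> cmod (a ^ n - 2)" for n
  proof -
    have "cmod (a ^ n) \<le> 1" using True by (simp add: norm_power power_le_one)
    moreover have "cmod 2 - cmod (a ^ n) \<le> cmod (a ^ n - 2)" by (metis norm_minus_commute norm_triangle_ineq2)
    ultimately have "1 \<le> cmod (a ^ n - 2)" by simp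
    thus ?thesis using True by (simp add: max_def)
  qed
  thus ?thesis by simp
next
  case False
  then obtain N where N: "4 < cmod a ^ N" using real_arch_pow[of "cmod a" 4] by auto
  have "cmod a ^ n \<ge> 4" if "n \<ge> N" for n
  proof -
    have "cmod a ^ N \<le> cmod a ^ n" using that False by (intro power_increasing) auto
    thus ?thesis using N by linarith
  qed
  hence "\<forall>\<^sub>F n in sequentially. cmod a ^ n \<ge> 4" by (rule eventually_sequentiallyI)
  thus ?thesis
  proof eventually_elim
    case (elim n)
    have "cmod (a ^ n) - cmod 2 \<le> cmod (a ^ n - 2)" by (rule norm_triangle_ineq2)
    thus ?case using elim False by (simp add: max_def norm_power)
  qed
qed

text \<open>Interchanging two products, as for a resultant, turns the product of \<open>g\<close>
  over the roots of \<open>z ^ n = 2\<close> into a power of the leading coefficient times the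
  product of \<open>a ^ n - 2\<close> over the roots \<open>a\<close> of \<open>g\<close>. The
  height \<open>B\<close> does not depend on \<open>n\<close>.\<close>

lemma card_residues_lower:
  fixes ev :: "int poly \<Rightarrow> 'b"
  assumes g: "g \<noteq> 0" and ev: "\<And>p q. ev p = ev q \<Longrightarrow> g dvd p - q"
  shows "\<exists>B\<ge>0. \<exists>c>0. \<forall>\<^sub>F n in sequentially. c * exp (log_mahler_measure g) ^ n \<le> real (card (ev ` poly_box n B))"
proof -
  obtain as where as: "cpoly g = smult (of_int (lead_coeff g)) (\<Prod>a\<leftarrow>as. [:-a, 1:])"
    "sorted (map cmod as)" "length as = degree g"
    and mahler: "exp (log_mahler_measure g) = \<bar>real_of_int (lead_coeff g)\<bar> * (\<Prod>a\<leftarrow>as. max 1 (cmod a))"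
    by (rule cpoly_factorization[OF g])
  have pg: "poly (cpoly g) z = of_int (lead_coeff g) * (\<Prod>a\<leftarrow>as. z - a)" for z
  proof -
    have "poly (\<Prod>a\<leftarrow>as. [:-a, 1:]) z = (\<Prod>a\<leftarrow>as. z - a)" for as :: "complex list"
      by (induction as) (auto simp: algebra_simps)
    thus ?thesis unfolding as(1) by simp
  qed
  define B where "B = 3 * coeff_norm1 g"
  \<comment> \<open>One factor 1/2 is lost at each root of \<open>g\<close>.\<close>
  define c :: real where "c = (1 / 2) ^ degree g"
  have "\<forall>\<^sub>F n in sequentially. \<forall>a\<in>set as. max 1 (cmod a) ^ n / 2 \<le> cmod (a ^ n - 2)"
    by (intro eventually_ball_finite ballI eventually_abs_power_minus_two) simp
  hence "\<forall>\<^sub>F n in sequentially. c * exp (log_mahler_measure g) ^ n \<le> real (card (ev ` poly_box n B))"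
    using eventually_gt_at_top[of "0::nat"] eventually_ge_at_top[of "degree g"]
  proof eventually_elim
    case (elim n)
    \<comment> \<open>For such \<open>n\<close> the lower bound on \<open>cmod (a ^ n - 2)\<close>
      excludes common roots of \<open>g\<close> and \<open>binom2 n\<close>.\<close>
    have nr: "z ^ n \<noteq> 2" if "poly (cpoly g) z = 0" for z
    proof
      assume "z ^ n = 2"
      have "z \<in> set as" using that g by (auto simp: pg prod_list_zero_iff)
      hence "max 1 (cmod z) ^ n / 2 \<le> 0" using elim(1) \<open>z ^ n = 2\<close> by force
      moreover have "max 1 (cmod z) ^ n > 0" by (intro zero_less_power) simp
      ultimately show False by simp
    qed
    have "card {z :: complex. z ^ n = 2} = n" using elim by (simp add: card_nth_roots)
    moreover have "finite {z :: complex. z ^ n = 2}" using elim by (intro finite_nth_roots) simp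
    ultimately obtain \<omega> where \<omega>: "bij_betw \<omega> {..<n} {z :: complex. z ^ n = 2}"
      using ex_bij_betw_nat_finite[of "{z :: complex. z ^ n = 2}"] by (auto simp: lessThan_atLeast0)
    have swap: "(\<Prod>i<n. \<Prod>a\<leftarrow>xs. cmod (\<omega> i - a)) = (\<Prod>a\<leftarrow>xs. cmod (a ^ n - 2))" for xs
    proof (induction xs)
      case (Cons a xs)
      have "(\<Prod>i<n. cmod (\<omega> i - a)) = cmod (\<Prod>i<n. a - \<omega> i)"
        by (simp add: prod_norm[symmetric] norm_minus_commute)
      thus ?case using Cons by (simp add: prod.distrib prod_linear_roots_of_two[OF elim(2) \<omega>])
    qed simp
    have cp: "cmod (\<Prod>a\<leftarrow>xs. z - a) = (\<Prod>a\<leftarrow>xs. cmod (z - a))" for xs z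
      by (induction xs) (auto simp: norm_mult)
    have "c * exp (log_mahler_measure g) ^ n = \<bar>real_of_int (lead_coeff g)\<bar> ^ n * (\<Prod>a\<leftarrow>as. max 1 (cmod a) ^ n / 2)"
    proof -
      have *: "(\<Prod>a\<leftarrow>xs. max 1 (cmod a) ^ n / 2) = (1 / 2) ^ length xs * (\<Prod>a\<leftarrow>xs. max 1 (cmod a)) ^ n" for xs
        by (induction xs) (auto simp: power_mult_distrib)
      show ?thesis unfolding * by (simp add: c_def mahler as(3) power_mult_distrib)
    qed
    also have "\<dots> \<le> \<bar>real_of_int (lead_coeff g)\<bar> ^ n * (\<Prod>a\<leftarrow>as. cmod (a ^ n - 2))"
      using elim(1) by (intro mult_left_mono prod_list_map_mono[THEN conjunct2]) auto
    also have "\<dots> = (\<Prod>i<n. cmod (poly (cpoly g) (\<omega> i)))"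
      by (simp add: pg norm_mult cp prod.distrib swap)
    also have "\<dots> \<le> real (card (ev ` poly_box n B))"
      unfolding B_def by (rule card_residues_ge_norm[OF elim(2,3) g nr ev \<omega>])
    finally show ?case .
  qed
  moreover have "c > 0" by (simp add: c_def)
  moreover have "B \<ge> 0" by (simp add: B_def coeff_norm1_def sum_nonneg)
  ultimately show ?thesis by blast
qed

section \<open>Subadditive sequences and exponential growth rates\<close>

text \<open>Fekete's lemma, the limit being the infimum \<open>l\<close> of the quotients: dividing
  \<open>n\<close> by a nearly optimal \<open>m\<close> gives
  \<open>u n \<le> real q * u m + C\<close>, where \<open>C\<close> bounds \<open>u\<close> on the
  remainders.\<close>

lemma fekete:
  fixes u :: "nat \<Rightarrow> real"
  assumes sub: "\<And>m n. u (m + n) \<le> u m + u n" and nonneg: "\<And>n. u n \<ge> 0"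
  shows "convergent (\<lambda>n. u n / real n)"
proof -
  define l where "l = Inf ((\<lambda>n. u n / real n) ` {1..})"
  have bdd: "bdd_below ((\<lambda>n. u n / real n) ` {1..})"
    by (rule bdd_belowI2[of _ 0]) (simp add: nonneg)
  have low: "l \<le> u n / real n" if "n \<ge> 1" for n
    unfolding l_def using that by (intro cInf_lower bdd) auto
  have mul: "u (q * m) \<le> real q * u m" if "q \<ge> 1" for q m
    using that
  proof (induction q rule: dec_induct)
    case (step q)
    have "u (Suc q * m) \<le> u m + u (q * m)" using sub[of m "q * m"] by simp
    thus ?case using step by (simp add: algebra_simps)
  qed simp
  have "(\<lambda>n. u n / real n) \<longlonglongrightarrow> l"
  proof (rule LIMSEQ_I)
    fix e :: real assume e: "e > 0"
    have "\<exists>x\<in>(\<lambda>n. u n / real n) ` {1..}. x < l + e / 2"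
      unfolding l_def using e by (intro cInf_lessD) (auto simp: l_def)
    then obtain m where m: "m \<ge> 1" "u m / real m < l + e / 2" by auto
    define C where "C = Max (u ` {..m})"
    have C: "u r \<le> C" if "r \<le> m" for r unfolding C_def using that by (intro Max_ge) auto
    have C0: "C \<ge> 0" using C[of 0] nonneg[of 0] by simp
    obtain n0 :: nat where n0: "real n0 > 2 * C / e" using reals_Archimedean2 by blast
    have "norm (u n / real n - l) < e" if n: "n \<ge> max n0 m" for n
    proof -
      have n1: "n \<ge> 1" using n m by simp
      define q where "q = n div m"
      have q: "q \<ge> 1" using n m by (simp add: q_def div_greater_zero_iff Suc_le_eq)
      have nq: "n = q * m + n mod m" by (simp add: q_def)
      have "u n \<le> u (q * m) + u (n mod m)" using sub[of "q * m" "n mod m"] nq by simp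
      also have "\<dots> \<le> real q * u m + C" using mul[OF q] C[of "n mod m"] m by (intro add_mono) auto
      finally have "u n / real n \<le> real q * u m / real n + C / real n"
        by (metis add_divide_distrib divide_right_mono of_nat_0_le_iff)
      also have "real q * u m / real n \<le> u m / real m"
      proof -
        have "real q * real m \<le> real n" using nq by (metis le_add1 of_nat_le_iff of_nat_mult)
        hence "u m * (real q * real m) \<le> u m * real n" using nonneg by (intro mult_left_mono) auto
        thus ?thesis using m n1 by (simp add: field_simps)
      qed
      also have "C / real n < e / 2"
      proof -
        have "2 * C / e < real n" using n0 n by linarith
        thus ?thesis using e n1 by (simp add: field_simps)
      qed
      finally have "u n / real n < l + e" using m(2) by linarith
      thus ?thesis using low[OF n1] e by simp
    qed
    thus "\<exists>n0. \<forall>n\<ge>n0. norm (u n / real n - l) < e" by blast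
  qed
  thus ?thesis by (rule convergentI)
qed

text \<open>Constant and polynomial factors disappear after taking logarithms and dividing by
  \<open>n\<close>.\<close>

lemma lim_log_card_le:
  fixes c :: "nat \<Rightarrow> nat"
  assumes lim: "(\<lambda>n. ln (real (c n)) / real n) \<longlonglongrightarrow> h" and pos: "\<And>n. c n > 0" and K: "K > 0"
    and le: "\<And>n. real (c n) \<le> K * real (n + 1) ^ d * exp m ^ n"
  shows "h \<le> m"
proof (rule tendsto_le[OF _ _ lim])
  have "(\<lambda>n. ln K / real n + real d * (ln (real (n + 1)) / real n) + m) \<longlonglongrightarrow> 0 + real d * 0 + m"
    by (intro tendsto_intros) real_asymp+
  thus "(\<lambda>n. ln K / real n + real d * (ln (real (n + 1)) / real n) + m) \<longlonglongrightarrow> m" by simp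
  show "\<forall>\<^sub>F n in sequentially. ln (real (c n)) / real n \<le> ln K / real n + real d * (ln (real (n + 1)) / real n) + m"
    using eventually_gt_at_top[of 0]
  proof eventually_elim
    case (elim n)
    have "ln (real (c n)) \<le> ln (K * real (n + 1) ^ d * exp m ^ n)" using le[of n] pos[of n] by (intro ln_mono) auto
    also have "\<dots> = ln K + real d * ln (real (n + 1)) + real n * m"
      using K by (simp add: ln_mult ln_realpow)
    finally show ?case using elim by (simp add: field_simps)
  qed
qed simp

lemma lim_log_card_ge:
  fixes c :: "nat \<Rightarrow> nat"
  assumes lim: "(\<lambda>n. ln (real (c n)) / real n) \<longlonglongrightarrow> h" and K: "K > 0"
    and le: "\<forall>\<^sub>F n in sequentially. K * exp m ^ n \<le> real (c n)"
  shows "m \<le> h"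
proof (rule tendsto_le[OF _ lim])
  have "(\<lambda>n. ln K / real n + m) \<longlonglongrightarrow> 0 + m"
    by real_asymp
  thus "(\<lambda>n. ln K / real n + m) \<longlonglongrightarrow> m" by simp
  show "\<forall>\<^sub>F n in sequentially. ln K / real n + m \<le> ln (real (c n)) / real n"
    using le eventually_gt_at_top[of 0]
  proof eventually_elim
    case (elim n)
    have "ln (K * exp m ^ n) \<le> ln (real (c n))" using elim K by (intro ln_mono) (auto intro: less_le_trans[rotated])
    moreover have "ln (K * exp m ^ n) = ln K + real n * m"
      using K by (simp add: ln_mult ln_realpow)
    ultimately have "(ln K + real n * m) / real n \<le> ln (real (c n)) / real n"
      by (intro divide_right_mono) auto
    thus ?case using elim by (simp add: add_divide_distrib)
  qed
qed simp

subsection \<open>Entropy of endomorphisms of abelian groups\<close>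

locale group_endo = comm_group G for G :: "'a monoid" (structure) +
  fixes \<phi> :: "'a \<Rightarrow> 'a"
  assumes endo: "\<phi> \<in> hom G G"
begin

lemma endo_closed [simp]: "x \<in> carrier G \<Longrightarrow> \<phi> x \<in> carrier G"
  using endo by (rule hom_in_carrier)

lemma endo_mult: "x \<in> carrier G \<Longrightarrow> y \<in> carrier G \<Longrightarrow> \<phi> (x \<otimes> y) = \<phi> x \<otimes> \<phi> y"
  using endo by (rule hom_mult)

lemma endo_one [simp]: "\<phi> \<one> = \<one>"
  by (rule hom_one[OF endo is_group is_group])

lemma endo_int_pow: "x \<in> carrier G \<Longrightarrow> \<phi> (x [^] (c :: int)) = \<phi> x [^] c"
  using hom_int_pow[OF endo _ is_group is_group] .

lemma funpow_closed [simp]: "x \<in> carrier G \<Longrightarrow> (\<phi> ^^ n) x \<in> carrier G"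
  by (induction n) auto

lemma funpow_mult:
  "x \<in> carrier G \<Longrightarrow> y \<in> carrier G \<Longrightarrow> (\<phi> ^^ n) (x \<otimes> y) = (\<phi> ^^ n) x \<otimes> (\<phi> ^^ n) y"
  by (induction n) (auto simp: endo_mult)

lemma funpow_image_subset: "A \<subseteq> carrier G \<Longrightarrow> (\<phi> ^^ n) ` A \<subseteq> carrier G"
  by auto

lemma funpow_set_mult:
  assumes "A \<subseteq> carrier G" "B \<subseteq> carrier G"
  shows "(\<phi> ^^ n) ` (A <#> B) = (\<phi> ^^ n) ` A <#> (\<phi> ^^ n) ` B"
proof -
  have "(\<phi> ^^ n) (a \<otimes> b) = (\<phi> ^^ n) a \<otimes> (\<phi> ^^ n) b" if "a \<in> A" "b \<in> B" for a b
    using that assms by (intro funpow_mult) auto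
  thus ?thesis unfolding set_mult_def by (auto simp: image_UN)
qed

lemma set_mult_comm: "A \<subseteq> carrier G \<Longrightarrow> B \<subseteq> carrier G \<Longrightarrow> A <#> B = B <#> A"
  unfolding set_mult_def by (force simp: m_comm subset_iff)

lemma set_mult_left_comm:
  "A \<subseteq> carrier G \<Longrightarrow> B \<subseteq> carrier G \<Longrightarrow> C \<subseteq> carrier G \<Longrightarrow> A <#> (B <#> C) = B <#> (A <#> C)"
  using set_mult_assoc[of A B C] set_mult_assoc[of B A C] set_mult_comm[of A B] by simp

lemma trajectory_closed: "F \<subseteq> carrier G \<Longrightarrow> trajectory G \<phi> F n \<subseteq> carrier G"
  by (induction n) (simp_all add: set_mult_closed funpow_image_subset)

lemma finite_set_mult: "finite A \<Longrightarrow> finite B \<Longrightarrow> finite (A <#> B)"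
  unfolding set_mult_def by auto

lemma card_set_mult_le:
  assumes "finite A" "finite B"
  shows "card (A <#> B) \<le> card A * card B"
proof -
  have "A <#> B = (\<lambda>(a, b). a \<otimes> b) ` (A \<times> B)" unfolding set_mult_def by auto
  thus ?thesis using card_image_le[of "A \<times> B" "\<lambda>(a, b). a \<otimes> b"] assms by (simp add: card_cartesian_product)
qed

lemma finite_trajectory: "finite F \<Longrightarrow> finite (trajectory G \<phi> F n)"
  by (induction n) (auto intro: finite_set_mult)

lemma trajectory_nonempty: "F \<noteq> {} \<Longrightarrow> trajectory G \<phi> F n \<noteq> {}"
  by (induction n) (auto simp: set_mult_def)

lemma card_trajectory_pos: "finite F \<Longrightarrow> F \<noteq> {} \<Longrightarrow> card (trajectory G \<phi> F n) > 0"
  by (simp add: card_gt_0_iff finite_trajectory trajectory_nonempty)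

lemma trajectory_add:
  assumes F: "F \<subseteq> carrier G"
  shows "trajectory G \<phi> F (m + n) = trajectory G \<phi> F m <#> (\<phi> ^^ m) ` trajectory G \<phi> F n"
proof (induction n)
  case 0
  have "(\<phi> ^^ m) \<one> = \<one>" by (induction m) auto
  thus ?case using trajectory_closed[OF F, of m] by (auto simp: set_mult_def subset_iff)
next
  case (Suc n)
  have "(\<phi> ^^ m) ` (\<phi> ^^ n) ` F = (\<phi> ^^ (m + n)) ` F" by (simp add: funpow_add image_comp)
  thus ?case
    using Suc F by (simp add: funpow_set_mult trajectory_closed funpow_image_subset set_mult_assoc)
qed

text \<open>\<open>entropy_at\<close> is a \<open>lim\<close>, which is informative only for
  convergent sequences. Convergence comes from \<open>fekete\<close>, since
  \<open>trajectory_add\<close> makes the logarithms subadditive.\<close>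

lemma entropy_at_tendsto:
  assumes F: "F \<subseteq> carrier G" "finite F" "F \<noteq> {}"
  shows "(\<lambda>n. ln (real (card (trajectory G \<phi> F n))) / real n) \<longlonglongrightarrow> entropy_at G \<phi> F"
proof -
  let ?u = "\<lambda>n. ln (real (card (trajectory G \<phi> F n)))"
  have pos: "card (trajectory G \<phi> F n) > 0" for n using card_trajectory_pos F by blast
  have "convergent (\<lambda>n. ?u n / real n)"
  proof (rule fekete)
    fix m n
    have "card (trajectory G \<phi> F (m + n)) \<le> card (trajectory G \<phi> F m) * card ((\<phi> ^^ m) ` trajectory G \<phi> F n)"
      unfolding trajectory_add[OF F(1)] using F by (intro card_set_mult_le finite_imageI finite_trajectory)
    also have "\<dots> \<le> card (trajectory G \<phi> F m) * card (trajectory G \<phi> F n)"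
      using F by (intro mult_left_mono card_image_le finite_trajectory) auto
    finally have "?u (m + n) \<le> ln (real (card (trajectory G \<phi> F m) * card (trajectory G \<phi> F n)))"
      using pos by (intro ln_mono) (auto simp flip: of_nat_mult)
    thus "?u (m + n) \<le> ?u m + ?u n" using pos by (simp add: ln_mult)
  next
    fix n show "?u n \<ge> 0" using pos[of n] by simp
  qed
  thus ?thesis unfolding entropy_at_def by (simp add: convergent_LIMSEQ_iff)
qed

lemma trajectory_mono: "F \<subseteq> F' \<Longrightarrow> trajectory G \<phi> F n \<subseteq> trajectory G \<phi> F' n"
  by (induction n) (simp_all add: mono_set_mult image_mono)

lemma entropy_at_mono:
  assumes "F \<subseteq> F'" "F' \<subseteq> carrier G" "finite F'" "F \<noteq> {}"
  shows "entropy_at G \<phi> F \<le> entropy_at G \<phi> F'"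
proof (rule LIMSEQ_le[OF entropy_at_tendsto entropy_at_tendsto])
  have "card (trajectory G \<phi> F n) > 0" for n
    using assms finite_subset by (intro card_trajectory_pos) auto
  moreover have "card (trajectory G \<phi> F n) \<le> card (trajectory G \<phi> F' n)" for n
    using assms by (intro card_mono finite_trajectory trajectory_mono)
  ultimately show "\<exists>N. \<forall>n\<ge>N. ln (real (card (trajectory G \<phi> F n))) / real n \<le> ln (real (card (trajectory G \<phi> F' n))) / real n"
    by (intro exI[of _ 0] allI impI divide_right_mono ln_mono) auto
qed (use assms finite_subset in auto)

lemma trajectory_set_mult:
  assumes "A \<subseteq> carrier G" "B \<subseteq> carrier G"
  shows "trajectory G \<phi> (A <#> B) n = trajectory G \<phi> A n <#> trajectory G \<phi> B n"
proof (induction n)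
  case 0 show ?case by (auto simp: set_mult_def)
next
  case (Suc n)
  let ?A = "trajectory G \<phi> A n" and ?B = "trajectory G \<phi> B n"
  let ?a = "(\<phi> ^^ n) ` A" and ?b = "(\<phi> ^^ n) ` B"
  have c: "?A \<subseteq> carrier G" "?B \<subseteq> carrier G" "?a \<subseteq> carrier G" "?b \<subseteq> carrier G"
    using assms by (auto intro: trajectory_closed[THEN subsetD])
  have "trajectory G \<phi> (A <#> B) (Suc n) = (?A <#> ?B) <#> (?a <#> ?b)"
    by (simp add: Suc funpow_set_mult assms)
  also have "\<dots> = (?A <#> ?a) <#> (?B <#> ?b)"
    using c by (simp add: set_mult_assoc set_mult_closed set_mult_left_comm)
  finally show ?case by simp
qed

text \<open>By commutativity the trajectory of a sumset is the sumset of the trajectories, so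
  cardinalities at worst multiply.\<close>

lemma entropy_at_set_mult_le:
  assumes A: "A \<subseteq> carrier G" "finite A" "A \<noteq> {}" and B: "B \<subseteq> carrier G" "finite B" "B \<noteq> {}"
  shows "entropy_at G \<phi> (A <#> B) \<le> entropy_at G \<phi> A + entropy_at G \<phi> B"
proof (rule LIMSEQ_le[OF entropy_at_tendsto tendsto_add[OF entropy_at_tendsto entropy_at_tendsto]])
  let ?T = "\<lambda>F n. card (trajectory G \<phi> F n)"
  have pos: "?T A n > 0" "?T B n > 0" "?T (A <#> B) n > 0" for n
    using A B by (auto intro!: card_trajectory_pos finite_set_mult simp: set_mult_def)
  have "ln (real (?T (A <#> B) n)) / real n \<le> ln (real (?T A n)) / real n + ln (real (?T B n)) / real n" for n
  proof -
    have "?T (A <#> B) n \<le> ?T A n * ?T B n"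
      unfolding trajectory_set_mult[OF A(1) B(1)] using A B by (intro card_set_mult_le finite_trajectory)
    hence "ln (real (?T (A <#> B) n)) \<le> ln (real (?T A n * ?T B n))"
      using pos(3)[of n] by (intro ln_mono) (auto simp flip: of_nat_mult)
    also have "\<dots> = ln (real (?T A n)) + ln (real (?T B n))" using pos[of n] by (simp add: ln_mult)
    finally show ?thesis by (metis add_divide_distrib divide_right_mono of_nat_0_le_iff)
  qed
  thus "\<exists>N. \<forall>n\<ge>N. ln (real (?T (A <#> B) n)) / real n \<le> ln (real (?T A n)) / real n + ln (real (?T B n)) / real n"
    by blast
qed (use A B in \<open>auto intro: finite_set_mult simp: set_mult_closed set_mult_def\<close>)

lemma entropy_at_le_algebraic_entropy:
  "F \<subseteq> carrier G \<Longrightarrow> finite F \<Longrightarrow> F \<noteq> {} \<Longrightarrow> ereal (entropy_at G \<phi> F) \<le> algebraic_entropy G \<phi>"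
  unfolding algebraic_entropy_def by (intro SUP_upper) auto

text \<open>The action of \<int>[t] on \<open>x\<close> with \<open>t\<close> acting as
  \<open>\<phi>\<close>, in Horner form.\<close>

definition orbit_eval :: "'a \<Rightarrow> int poly \<Rightarrow> 'a" where
  "orbit_eval x p = fold_coeffs (\<lambda>c y. x [^] c \<otimes> \<phi> y) p \<one>"

lemma orbit_eval_0 [simp]: "orbit_eval x 0 = \<one>"
  by (simp add: orbit_eval_def)

lemma orbit_eval_pCons [simp]:
  assumes "x \<in> carrier G"
  shows "orbit_eval x (pCons c p) = x [^] c \<otimes> \<phi> (orbit_eval x p)"
  using assms by (cases "c = 0 \<and> p = 0") (auto simp: orbit_eval_def)

lemma orbit_eval_closed [simp]: "x \<in> carrier G \<Longrightarrow> orbit_eval x p \<in> carrier G"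
  by (induction p) auto

lemma orbit_eval_add: "x \<in> carrier G \<Longrightarrow> orbit_eval x (p + q) = orbit_eval x p \<otimes> orbit_eval x q"
  by (induction p q rule: poly_induct2) (auto simp: int_pow_mult endo_mult m_ac)

lemma orbit_eval_smult: "x \<in> carrier G \<Longrightarrow> orbit_eval x (smult c p) = orbit_eval x p [^] c"
  by (induction p) (auto simp: int_pow_distrib endo_int_pow int_pow_pow mult.commute)

lemma orbit_eval_monom: "x \<in> carrier G \<Longrightarrow> orbit_eval x (monom c n) = (\<phi> ^^ n) (x [^] c)"
  by (induction n) (auto simp: monom_0 monom_Suc)

text \<open>The annihilator of \<open>x\<close>: the subgroup generated by the orbit of
  \<open>x\<close> is \<int>[t] modulo this ideal.\<close>

definition orbit_kernel :: "'a \<Rightarrow> int poly set" where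
  "orbit_kernel x = {p. orbit_eval x p = \<one>}"

lemma poly_ideal_orbit_kernel:
  assumes x: "x \<in> carrier G"
  shows "poly_ideal (orbit_kernel x)"
  unfolding poly_ideal_def
proof safe
  fix p r assume p: "p \<in> orbit_kernel x"
  show "r * p \<in> orbit_kernel x"
    by (induction r) (use p x in \<open>auto simp: orbit_kernel_def orbit_eval_add orbit_eval_smult\<close>)
qed (use x in \<open>auto simp: orbit_kernel_def orbit_eval_add\<close>)

lemma orbit_eval_eq_iff:
  assumes x: "x \<in> carrier G"
  shows "orbit_eval x p = orbit_eval x q \<longleftrightarrow> p - q \<in> orbit_kernel x"
proof -
  have "orbit_eval x p = orbit_eval x (p - q) \<otimes> orbit_eval x q"
    using orbit_eval_add[OF x, of "p - q" q] by simp
  thus ?thesis using x by (simp add: orbit_kernel_def)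
qed

definition cyclic_segment :: "'a \<Rightarrow> int \<Rightarrow> 'a set" where
  "cyclic_segment x B = (\<lambda>c. x [^] c) ` {-B..B}"

lemma cyclic_segment:
  assumes "x \<in> carrier G" "B \<ge> 0"
  shows "cyclic_segment x B \<subseteq> carrier G" "finite (cyclic_segment x B)" "cyclic_segment x B \<noteq> {}" "\<one> \<in> cyclic_segment x B"
proof -
  show "cyclic_segment x B \<subseteq> carrier G" "finite (cyclic_segment x B)" using assms by (auto simp: cyclic_segment_def)
  have "x [^] (0 :: int) \<in> cyclic_segment x B" unfolding cyclic_segment_def using assms by (intro imageI) simp
  thus "\<one> \<in> cyclic_segment x B" by simp
  thus "cyclic_segment x B \<noteq> {}" by blast
qed

text \<open>The image of the segment under the \<open>n\<close>-th iterate supplies the coefficient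
  of index \<open>n\<close>. This turns entropy into counting boxes modulo
  \<open>orbit_kernel x\<close>.\<close>

lemma trajectory_cyclic_segment:
  assumes x: "x \<in> carrier G" and B: "B \<ge> 0"
  shows "trajectory G \<phi> (cyclic_segment x B) n = orbit_eval x ` poly_box n B"
proof (induction n)
  case 0
  have "poly_box 0 B = {0}" using B by (auto simp: poly_box_def poly_eq_iff)
  thus ?case by simp
next
  case (Suc n)
  have box: "poly_box (Suc n) B = (\<lambda>(p, c). p + monom c n) ` (poly_box n B \<times> {-B..B})"
  proof safe
    fix p assume p: "p \<in> poly_box (Suc n) B"
    have "p = poly_cutoff n p + monom (coeff p n) n"
      using p by (intro poly_eqI) (auto simp: coeff_poly_cutoff poly_box_def not_less Suc_le_eq)
    moreover have "poly_cutoff n p \<in> poly_box n B" "coeff p n \<in> {-B..B}"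
      using p B by (auto simp: coeff_poly_cutoff poly_box_def abs_le_iff minus_le_iff)
    ultimately show "p \<in> (\<lambda>(p, c). p + monom c n) ` (poly_box n B \<times> {-B..B})"
      by (metis (no_types, lifting) SigmaI case_prod_conv image_eqI)
  next
    fix p c assume "p \<in> poly_box n B" "c \<in> {-B..B}"
    thus "p + monom c n \<in> poly_box (Suc n) B"
      by (auto simp: poly_box_def abs_le_iff minus_le_iff)
  qed
  have "trajectory G \<phi> (cyclic_segment x B) (Suc n) = orbit_eval x ` poly_box n B <#> (\<lambda>c. (\<phi> ^^ n) (x [^] c)) ` {-B..B}"
    by (simp only: trajectory.simps Suc) (simp only: cyclic_segment_def image_image)
  also have "\<dots> = (\<lambda>(p, c). orbit_eval x p \<otimes> (\<phi> ^^ n) (x [^] c)) ` (poly_box n B \<times> {-B..B})"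
    unfolding set_mult_def by auto
  also have "\<dots> = orbit_eval x ` poly_box (Suc n) B"
    unfolding box image_image using x by (intro image_cong) (auto simp: orbit_eval_add orbit_eval_monom)
  finally show ?case .
qed

text \<open>If \<open>g\<close> divides the whole kernel, \<open>orbit_eval x\<close> separates the
  classes modulo \<open>g\<close>, and the lower count applies to it.\<close>

lemma log_mahler_measure_le_entropy:
  assumes x: "x \<in> carrier G" and g: "g \<noteq> 0" "\<forall>p\<in>orbit_kernel x. g dvd p"
  shows "ereal (log_mahler_measure g) \<le> algebraic_entropy G \<phi>"
proof -
  obtain B c where B: "B \<ge> 0" "c > 0"
    "\<forall>\<^sub>F n in sequentially. c * exp (log_mahler_measure g) ^ n \<le> real (card (orbit_eval x ` poly_box n B))"
    using card_residues_lower[OF g(1), of "orbit_eval x"] g(2) orbit_eval_eq_iff[OF x] by blast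
  note seg = cyclic_segment[OF x B(1)]
  have "log_mahler_measure g \<le> entropy_at G \<phi> (cyclic_segment x B)"
    using B(3) by (intro lim_log_card_ge[OF entropy_at_tendsto[OF seg(1-3)] B(2)])
      (simp add: trajectory_cyclic_segment[OF x B(1)])
  thus ?thesis by (intro order_trans[OF _ entropy_at_le_algebraic_entropy[OF seg(1-3)]]) simp
qed

text \<open>Although \<open>w\<close> need not annihilate \<open>x\<close>, its multiples fall into
  at most \<open>card R\<close> classes modulo the kernel, so counting modulo \<open>w\<close>
  instead costs a constant factor.\<close>

lemma entropy_at_cyclic_segment_le:
  assumes x: "x \<in> carrier G" and B: "B \<ge> 0" and w: "w \<noteq> 0" and R: "finite R"
    and kernel: "\<And>s. \<exists>r\<in>R. w * (s - r) \<in> orbit_kernel x"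
  shows "entropy_at G \<phi> (cyclic_segment x B) \<le> log_mahler_measure w"
proof -
  define cl where "cl p = {q. w dvd p - q}" for p
  have cl: "cl p = cl q \<longleftrightarrow> w dvd p - q" for p q
  proof
    assume eq: "cl p = cl q"
    have "q \<in> cl q" by (simp add: cl_def)
    hence "q \<in> cl p" unfolding eq .
    thus "w dvd p - q" by (simp add: cl_def)
  next
    assume *: "w dvd p - q"
    have "w dvd p - u \<longleftrightarrow> w dvd q - u" for u
      using dvd_add_right_iff[OF *, of "q - u"] by simp
    thus "cl p = cl q" unfolding cl_def by blast
  qed
  have "\<exists>K>0. \<exists>d. \<forall>n. real (card (cl ` poly_box n B)) \<le> K * real (n + 1) ^ d * exp (log_mahler_measure w) ^ n"
    by (rule card_residues_upper[OF w B]) (simp only: cl)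
  then obtain K d where K: "K > 0" and Kd: "\<And>n. real (card (cl ` poly_box n B)) \<le> K * real (n + 1) ^ d * exp (log_mahler_measure w) ^ n"
    by blast
  have "R \<noteq> {}" using kernel by blast
  hence R0: "card R > 0" using R by (simp add: card_gt_0_iff)
  have le: "card (orbit_eval x ` poly_box n B) \<le> card R * card (cl ` poly_box n B)" for n
  proof -
    \<comment> \<open>\<open>\<sigma>\<close> selects a polynomial of the box from each class modulo
      \<open>w\<close>.\<close>
    define \<sigma> where "\<sigma> = inv_into (poly_box n B) cl"
    have "orbit_eval x ` poly_box n B \<subseteq> (\<lambda>(r, c). orbit_eval x (\<sigma> c + w * r)) ` (R \<times> cl ` poly_box n B)"
    proof
      fix y assume "y \<in> orbit_eval x ` poly_box n B"
      then obtain p where p: "p \<in> poly_box n B" "y = orbit_eval x p" by auto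
      have "cl (\<sigma> (cl p)) = cl p" unfolding \<sigma>_def using p(1) by (intro f_inv_into_f) simp
      hence "w dvd p - \<sigma> (cl p)" using cl[of p "\<sigma> (cl p)"] by simp
      then obtain s where s: "p - \<sigma> (cl p) = w * s" by (rule dvdE)
      obtain r where r: "r \<in> R" "w * (s - r) \<in> orbit_kernel x" using kernel by blast
      have "p - (\<sigma> (cl p) + w * r) = w * (s - r)" using s by (simp add: algebra_simps)
      hence "p - (\<sigma> (cl p) + w * r) \<in> orbit_kernel x" using r(2) by simp
      hence "y = (\<lambda>(r, c). orbit_eval x (\<sigma> c + w * r)) (r, cl p)"
        using orbit_eval_eq_iff[OF x] p(2) by simp
      moreover have "(r, cl p) \<in> R \<times> cl ` poly_box n B" using r(1) p(1) by simp
      ultimately show "y \<in> (\<lambda>(r, c). orbit_eval x (\<sigma> c + w * r)) ` (R \<times> cl ` poly_box n B)"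
        by (rule image_eqI)
    qed
    moreover have fin: "finite (R \<times> cl ` poly_box n B)" using R by simp
    ultimately have "card (orbit_eval x ` poly_box n B) \<le>
        card ((\<lambda>(r, c). orbit_eval x (\<sigma> c + w * r)) ` (R \<times> cl ` poly_box n B))"
      by (intro card_mono finite_imageI)
    also have "\<dots> \<le> card (R \<times> cl ` poly_box n B)" using fin by (rule card_image_le)
    finally show ?thesis by (simp add: card_cartesian_product)
  qed
  note seg = cyclic_segment[OF x B]
  show ?thesis
  proof (rule lim_log_card_le[OF entropy_at_tendsto[OF seg(1-3)]])
    show "card (trajectory G \<phi> (cyclic_segment x B) n) > 0" for n using card_trajectory_pos seg by blast
    show "real (card R) * K > 0" using R0 K by simp
    show "real (card (trajectory G \<phi> (cyclic_segment x B) n)) \<le> (real (card R) * K) * real (n + 1) ^ d * exp (log_mahler_measure w) ^ n" for n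
    proof -
      have "real (card (trajectory G \<phi> (cyclic_segment x B) n)) \<le> real (card R) * real (card (cl ` poly_box n B))"
        unfolding trajectory_cyclic_segment[OF x B] using le[of n] by (simp flip: of_nat_mult)
      also have "\<dots> \<le> real (card R) * (K * real (n + 1) ^ d * exp (log_mahler_measure w) ^ n)"
        by (intro mult_left_mono Kd) simp
      finally show ?thesis by (simp add: mult.assoc)
    qed
  qed
qed

text \<open>A finite set lies in the sumset of the segments of its elements, and entropy is
  subadditive on sumsets.\<close>

lemma entropy_at_le_0I:
  assumes F: "finite F" "F \<subseteq> carrier G" "F \<noteq> {}"
    and le: "\<And>x. x \<in> carrier G \<Longrightarrow> entropy_at G \<phi> (cyclic_segment x 1) \<le> 0"
  shows "entropy_at G \<phi> F \<le> 0"
proof -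
  \<comment> \<open>With \<open>\<one>\<close> in \<open>E\<close> the new \<open>x\<close> lies in
    the sumset of its segment and \<open>E\<close>; \<open>\<one>\<close> in the segment keeps the
    old elements.\<close>
  have "\<exists>E. F \<subseteq> E \<and> \<one> \<in> E \<and> finite E \<and> E \<subseteq> carrier G \<and> entropy_at G \<phi> E \<le> 0"
    using F(1,2)
  proof (induction F)
    case empty
    have "\<one> \<in> carrier G" by simp
    from cyclic_segment[OF this, of 1] le[OF this] show ?case
      by (intro exI[of _ "cyclic_segment \<one> 1"]) auto
  next
    case (insert x F)
    then obtain E where E: "F \<subseteq> E" "\<one> \<in> E" "finite E" "E \<subseteq> carrier G" "entropy_at G \<phi> E \<le> 0" by auto
    have x: "x \<in> carrier G" using insert by simp
    note seg = cyclic_segment[OF x, of 1]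
    let ?E = "cyclic_segment x 1 <#> E"
    have "x [^] (1 :: int) \<in> cyclic_segment x 1" unfolding cyclic_segment_def by (intro imageI) simp
    hence "x \<in> cyclic_segment x 1" using x by simp
    hence "x \<otimes> \<one> \<in> ?E" unfolding set_mult_def using E by blast
    hence 1: "x \<in> ?E" using x by simp
    have 2: "y \<in> ?E" if "y \<in> E" for y
    proof -
      have "\<one> \<otimes> y \<in> ?E" unfolding set_mult_def using seg that by auto
      thus ?thesis using that E(4) by (simp add: subset_iff)
    qed
    have "entropy_at G \<phi> ?E \<le> entropy_at G \<phi> (cyclic_segment x 1) + entropy_at G \<phi> E"
      using seg E by (intro entropy_at_set_mult_le) auto
    also have "\<dots> \<le> 0" using le[OF x] E(5) by simp
    finally show ?case using 1 2 E seg
      by (intro exI[of _ ?E]) (auto intro: finite_set_mult simp: set_mult_closed)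
  qed
  then obtain E where E: "F \<subseteq> E" "finite E" "E \<subseteq> carrier G" "entropy_at G \<phi> E \<le> 0" by blast
  thus ?thesis using entropy_at_mono[OF E(1,3,2) F(3)] by simp
qed

end

section \<open>Lehmer's infimum as a lower bound for positive entropy\<close>

lemma log_mahler_measure_const: "log_mahler_measure [:c:] = ln \<bar>real_of_int c\<bar>"
proof -
  have "cpoly [:c:] = [:of_int c:]" by (rule poly_eqI) (simp add: coeff_map_poly coeff_pCons split: nat.split)
  thus ?thesis by (simp add: log_mahler_measure_def)
qed

text \<open>The witness t - 2 is monic with the single root 2.\<close>

lemma lehmer_inf_le_ln2: "lehmer_inf \<le> ereal (ln 2)"
proof -
  have "map_poly complex_of_int [:- 2, 1:] = [:- 2, 1:]" by (simp add: map_poly_pCons)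
  hence "log_mahler_measure [:- 2, 1:] = ln 2" by (simp add: log_mahler_measure_def)
  moreover have "content [:- 2, 1 :: int:] = 1" by (simp add: content_eq_fold_coeffs fold_coeffs_def)
  ultimately show ?thesis unfolding lehmer_inf_def by (intro Inf_lower CollectI exI[of _ "[:- 2, 1:]"]) auto
qed

text \<open>By \<open>entropy_at_le_0I\<close> some cyclic orbit already has positive entropy. If
  its kernel has finite index in the multiples of \<open>w\<close>, the upper count shows that
  \<open>w\<close> has positive measure, and the lower count compares this measure with the entropy
  of \<open>\<phi>\<close>.\<close>

lemma (in group_endo) lehmer_inf_le_algebraic_entropy:
  assumes "0 < algebraic_entropy G \<phi>"
  shows "lehmer_inf \<le> algebraic_entropy G \<phi>"
proof -
  have "\<exists>x\<in>carrier G. entropy_at G \<phi> (cyclic_segment x 1) > 0"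
  proof (rule ccontr)
    assume "\<not> ?thesis"
    hence "entropy_at G \<phi> (cyclic_segment x 1) \<le> 0" if "x \<in> carrier G" for x
      using that by (meson not_less)
    hence "entropy_at G \<phi> F \<le> 0" if "finite F" "F \<subseteq> carrier G" "F \<noteq> {}" for F
      using entropy_at_le_0I[OF that] by blast
    hence "algebraic_entropy G \<phi> \<le> 0" unfolding algebraic_entropy_def by (intro SUP_least) auto
    thus False using assms by simp
  qed
  then obtain x where x: "x \<in> carrier G" "entropy_at G \<phi> (cyclic_segment x 1) > 0" by blast
  \<comment> \<open>The lower count is applied to the constant polynomial \<open>c\<close>, whose
    measure is \<open>ln c\<close>.\<close>
  have big: "lehmer_inf \<le> algebraic_entropy G \<phi>" if c: "c \<ge> 2" "\<forall>q\<in>orbit_kernel x. [:c:] dvd q" for c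
  proof -
    have "ln 2 \<le> log_mahler_measure [:c:]" unfolding log_mahler_measure_const using c(1) by (intro ln_mono) auto
    moreover have "[:c:] \<noteq> 0" using c(1) by simp
    ultimately show ?thesis
      using order_trans[OF lehmer_inf_le_ln2 order_trans[OF _ log_mahler_measure_le_entropy[OF x(1) _ c(2)]]] by simp
  qed
  show ?thesis
  proof (cases "\<exists>p\<in>orbit_kernel x. p \<noteq> 0")
    case False
    \<comment> \<open>The free case: a zero kernel is divisible by every constant.\<close>
    hence "\<forall>q\<in>orbit_kernel x. [:2:] dvd q" by auto
    thus ?thesis by (intro big[of 2]) simp_all
  next
    case True
    from poly_ideal_cases[OF poly_ideal_orbit_kernel[OF x(1)] True] show ?thesis
    proof (elim disjE exE conjE)
      fix c :: int assume "2 \<le> c" "\<forall>q\<in>orbit_kernel x. [:c:] dvd q"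
      thus ?thesis by (rule big)
    next
      fix w R assume w: "content w = 1" and R: "finite R" and dvd: "\<forall>q\<in>orbit_kernel x. w dvd q"
        and kernel: "\<forall>s. \<exists>r\<in>R. w * (s - r) \<in> orbit_kernel x"
      have w0: "w \<noteq> 0" using w by auto
      have "entropy_at G \<phi> (cyclic_segment x 1) \<le> log_mahler_measure w"
        using kernel by (intro entropy_at_cyclic_segment_le[OF x(1) _ w0 R]) auto
      hence "0 < log_mahler_measure w" using x(2) by simp
      hence "lehmer_inf \<le> ereal (log_mahler_measure w)"
        unfolding lehmer_inf_def using w by (intro Inf_lower) auto
      also have "\<dots> \<le> algebraic_entropy G \<phi>" by (rule log_mahler_measure_le_entropy[OF x(1) w0 dvd])
      finally show ?thesis .
    qed
  qed
qed

section \<open>Transport of entropy along isomorphisms and embeddings\<close>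

lemma algebraic_entropy_transport:
  assumes G: "group G" "\<phi> \<in> hom G G" and H: "group H"
    and \<iota>: "\<iota> \<in> hom G H" "bij_betw \<iota> (carrier G) (carrier H)"
    and comm: "\<And>x. x \<in> carrier G \<Longrightarrow> \<phi>' (\<iota> x) = \<iota> (\<phi> x)"
  shows "algebraic_entropy H \<phi>' = algebraic_entropy G \<phi>"
proof -
  have it: "(\<phi> ^^ n) x \<in> carrier G \<and> (\<phi>' ^^ n) (\<iota> x) = \<iota> ((\<phi> ^^ n) x)" if "x \<in> carrier G" for n x
    using that by (induction n) (auto simp: comm hom_in_carrier[OF G(2)])
  have traj: "trajectory G \<phi> F n \<subseteq> carrier G \<and> trajectory H \<phi>' (\<iota> ` F) n = \<iota> ` trajectory G \<phi> F n"
    if F: "F \<subseteq> carrier G" for F n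
  proof (induction n)
    case 0
    show ?case using hom_one[OF \<iota>(1) G(1) H] G(1) by (auto simp: group.is_monoid)
  next
    case (Suc n)
    have c: "(\<phi> ^^ n) ` F \<subseteq> carrier G" using it F by auto
    have "(\<phi>' ^^ n) ` \<iota> ` F = \<iota> ` (\<phi> ^^ n) ` F"
      unfolding image_image using it F by (intro image_cong) auto
    moreover have "\<iota> ` (A <#>\<^bsub>G\<^esub> B) = \<iota> ` A <#>\<^bsub>H\<^esub> \<iota> ` B" if "A \<subseteq> carrier G" "B \<subseteq> carrier G" for A B
    proof -
      have "\<iota> (a \<otimes>\<^bsub>G\<^esub> b) = \<iota> a \<otimes>\<^bsub>H\<^esub> \<iota> b" if "a \<in> A" "b \<in> B" for a b
        using that \<open>A \<subseteq> carrier G\<close> \<open>B \<subseteq> carrier G\<close> by (intro hom_mult[OF \<iota>(1)]) auto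
      thus ?thesis unfolding set_mult_def by (auto simp: image_UN)
    qed
    moreover have "trajectory G \<phi> F n <#>\<^bsub>G\<^esub> (\<phi> ^^ n) ` F \<subseteq> carrier G"
      using Suc c G(1) by (auto simp: set_mult_def subset_iff group.is_monoid monoid.m_closed)
    ultimately show ?case using Suc c by simp
  qed
  have ent: "entropy_at H \<phi>' (\<iota> ` F) = entropy_at G \<phi> F" if F: "F \<subseteq> carrier G" for F
  proof -
    have "card (trajectory H \<phi>' (\<iota> ` F) n) = card (trajectory G \<phi> F n)" for n
      using traj[OF F, of n] \<iota>(2) by (auto simp: bij_betw_def intro!: card_image inj_on_subset[of \<iota> "carrier G"])
    thus ?thesis by (simp add: entropy_at_def)
  qed
  have "{F. F \<subseteq> carrier H \<and> finite F \<and> F \<noteq> {}} = (`) \<iota> ` {F. F \<subseteq> carrier G \<and> finite F \<and> F \<noteq> {}}"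
  proof (intro subset_antisym subsetI)
    fix F assume "F \<in> {F. F \<subseteq> carrier H \<and> finite F \<and> F \<noteq> {}}"
    hence F: "F \<subseteq> carrier H" "finite F" "F \<noteq> {}" by auto
    then obtain F' where "F' \<subseteq> carrier G" "F = \<iota> ` F'" "inj_on \<iota> F'"
      using \<iota>(2) subset_image_inj[of F \<iota> "carrier G"] by (auto simp: bij_betw_def)
    thus "F \<in> (`) \<iota> ` {F. F \<subseteq> carrier G \<and> finite F \<and> F \<noteq> {}}"
      using F by (intro image_eqI[of _ _ F']) (auto dest: finite_imageD)
  next
    fix F assume "F \<in> (`) \<iota> ` {F. F \<subseteq> carrier G \<and> finite F \<and> F \<noteq> {}}"
    thus "F \<in> {F. F \<subseteq> carrier H \<and> finite F \<and> F \<noteq> {}}" using \<iota>(2) by (auto simp: bij_betw_def)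
  qed
  thus ?thesis unfolding algebraic_entropy_def by (simp add: image_image ent cong: image_cong_simp)
qed

text \<open>The group structure is copied onto the image of \<open>\<iota>\<close>; in this way
  groups over other types enter the infimum over \<open>'a\<close>.\<close>

lemma algebraic_entropy_transport_inj:
  fixes G :: "'b monoid" and \<iota> :: "'b \<Rightarrow> 'a"
  assumes G: "comm_group G" "\<phi> \<in> hom G G" and \<iota>: "inj_on \<iota> (carrier G)"
  shows "\<exists>(H :: 'a monoid) \<phi>'. comm_group H \<and> \<phi>' \<in> hom H H \<and> algebraic_entropy H \<phi>' = algebraic_entropy G \<phi>"
proof -
  interpret G: comm_group G by fact
  define \<kappa> where "\<kappa> = inv_into (carrier G) \<iota>"
  have \<kappa>[simp]: "\<kappa> (\<iota> x) = x" if "x \<in> carrier G" for x using \<iota> that by (simp add: \<kappa>_def)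
  define H where "H = \<lparr>carrier = \<iota> ` carrier G, monoid.mult = \<lambda>a b. \<iota> (\<kappa> a \<otimes>\<^bsub>G\<^esub> \<kappa> b), one = \<iota> \<one>\<^bsub>G\<^esub>\<rparr>"
  define \<phi>' where "\<phi>' = \<iota> \<circ> \<phi> \<circ> \<kappa>"
  have H: "comm_group H"
  proof (rule comm_groupI)
    fix x assume "x \<in> carrier H"
    then obtain a where a: "x = \<iota> a" "a \<in> carrier G" by (auto simp: H_def)
    show "\<exists>y\<in>carrier H. y \<otimes>\<^bsub>H\<^esub> x = \<one>\<^bsub>H\<^esub>"
      using a by (intro bexI[of _ "\<iota> (inv\<^bsub>G\<^esub> a)"]) (auto simp: H_def)
  qed (auto simp: H_def G.m_ac)
  have \<phi>c: "\<phi> x \<in> carrier G" if "x \<in> carrier G" for x using G(2) that by (rule hom_in_carrier)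
  have hom: "\<phi>' \<in> hom H H" using G(2) \<phi>c by (auto simp: hom_def H_def \<phi>'_def)
  have "algebraic_entropy H \<phi>' = algebraic_entropy G \<phi>"
  proof (rule algebraic_entropy_transport[OF G.is_group G(2) comm_group.axioms(2)[OF H]])
    show "\<iota> \<in> hom G H" by (auto simp: hom_def H_def)
    show "bij_betw \<iota> (carrier G) (carrier H)" using \<iota> by (simp add: bij_betw_def H_def)
  qed (simp add: \<phi>'_def)
  thus ?thesis using H hom by blast
qed

lemma countable_carrier_vec: "countable (carrier_vec n :: 'b :: countable vec set)"
proof -
  have "inj_on list_of_vec (carrier_vec n :: 'b vec set)"
    by (metis inj_onI vec_list)
  thus ?thesis by (rule countable_image_inj_on[rotated]) simp
qed

text \<open>Rational vectors of fixed length form a countable set, which embeds into any infinite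
  type.\<close>

lemma entropy_inf_le_rat_aut_entropy_inf:
  assumes "infinite (UNIV :: 'a set)"
  shows "entropy_inf TYPE('a) \<le> rat_aut_entropy_inf"
  unfolding rat_aut_entropy_inf_def
proof (rule Inf_greatest, clarify)
  fix n :: nat and \<phi>
  let ?G = "monoid_vec TYPE(rat) n"
  assume \<phi>: "\<phi> \<in> iso ?G ?G" and pos: "0 < algebraic_entropy ?G \<phi>"
  obtain e :: "nat \<Rightarrow> 'a" where e: "inj e" using infinite_countable_subset[OF assms] by blast
  have "inj_on (to_nat_on (carrier_vec n :: rat vec set)) (carrier ?G)"
    by (simp only: monoid_vec_simps inj_on_to_nat_on[OF countable_carrier_vec])
  hence "inj_on (e \<circ> to_nat_on (carrier_vec n :: rat vec set)) (carrier ?G)"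
    using e by (intro comp_inj_on) (auto intro: inj_on_subset)
  from algebraic_entropy_transport_inj[OF comm_group_vec _ this, of \<phi>] \<phi>
  obtain H :: "'a monoid" and \<phi>' where "comm_group H" "\<phi>' \<in> hom H H"
    "algebraic_entropy H \<phi>' = algebraic_entropy ?G \<phi>" by (auto simp: iso_def)
  with pos show "entropy_inf TYPE('a) \<le> algebraic_entropy ?G \<phi>"
    unfolding entropy_inf_def by (intro Inf_lower CollectI exI[of _ H] exI[of _ \<phi>']) auto
qed

lemma lehmer_inf_le_entropy_inf: "lehmer_inf \<le> entropy_inf TYPE('a)"
  unfolding entropy_inf_def
proof (rule Inf_greatest, clarify)
  fix G :: "'a monoid" and \<phi>
  assume "comm_group G" "\<phi> \<in> hom G G" and pos: "0 < algebraic_entropy G \<phi>"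
  then interpret group_endo G \<phi> by (simp add: group_endo_def group_endo_axioms_def)
  show "lehmer_inf \<le> algebraic_entropy G \<phi>" using pos by (rule lehmer_inf_le_algebraic_entropy)
qed

section \<open>Upper entropy bound for finite sets in a cyclic orbit\<close>

context group_endo
begin

text \<open>The coefficient of index \<open>i\<close> receives contributions only from shifts
  \<open>j\<close> with \<open>j \<le> i < j + n\<close>, at most \<open>n\<close> of them. So the
  height stays bounded while the number of summands grows.\<close>

lemma trajectory_orbit_eval_subset:
  assumes x: "x \<in> carrier G" and B: "B \<ge> 0"
  shows "trajectory G \<phi> (orbit_eval x ` poly_box n B) m \<subseteq> orbit_eval x ` poly_box (m + n) (int n * B)"
proof -
  \<comment> \<open>The exact number of shifts reaching index \<open>i\<close> is recorded, since
    the uniform bound \<open>n\<close> is not inductive.\<close>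
  define Q where "Q m = {p. (\<forall>i\<ge>m + n. coeff p i = 0) \<and> (\<forall>i. \<bar>coeff p i\<bar> \<le> int (card {j. j < m \<and> j \<le> i \<and> i < j + n}) * B)}" for m
  have "trajectory G \<phi> (orbit_eval x ` poly_box n B) m \<subseteq> orbit_eval x ` Q m"
  proof (induction m)
    case 0
    have "0 \<in> Q 0" by (simp add: Q_def)
    thus ?case by force
  next
    case (Suc m)
    show ?case
    proof
      fix y assume "y \<in> trajectory G \<phi> (orbit_eval x ` poly_box n B) (Suc m)"
      then obtain p q where p: "p \<in> Q m" and q: "q \<in> poly_box n B" and y: "y = orbit_eval x p \<otimes> (\<phi> ^^ m) (orbit_eval x q)"
        using Suc by (force simp: set_mult_def)
      have shift: "orbit_eval x (monom 1 m * q) = (\<phi> ^^ m) (orbit_eval x q)"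
        by (induction m) (use x in \<open>auto simp: monom_Suc\<close>)
      have "\<bar>coeff (p + monom 1 m * q) i\<bar> \<le> int (card {j. j < Suc m \<and> j \<le> i \<and> i < j + n}) * B" for i
      proof -
        let ?J = "\<lambda>m. {j. j < m \<and> j \<le> i \<and> i < j + n}"
        have fin: "finite (?J m)" by simp
        have pi: "\<bar>coeff p i\<bar> \<le> int (card (?J m)) * B" using p by (simp add: Q_def)
        show ?thesis
        proof (cases "m \<le> i \<and> i < m + n")
          case True
          have "?J (Suc m) = insert m (?J m)" using True by auto
          hence "card (?J (Suc m)) = Suc (card (?J m))" using fin by simp
          moreover have "\<bar>coeff q (i - m)\<bar> \<le> B" using q by (simp add: poly_box_def)
          moreover have "coeff (p + monom 1 m * q) i = coeff p i + coeff q (i - m)"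
            using True by (simp add: coeff_monom_mult)
          ultimately show ?thesis using pi by (simp add: distrib_right)
        next
          case False
          hence "?J (Suc m) = ?J m" by (auto simp: less_Suc_eq)
          moreover have "coeff (monom 1 m * q) i = 0" using False q by (auto simp: coeff_monom_mult poly_box_def)
          ultimately show ?thesis using pi by simp
        qed
      qed
      moreover have "coeff (p + monom 1 m * q) i = 0" if "i \<ge> Suc m + n" for i
        using p q that by (simp add: Q_def poly_box_def coeff_monom_mult)
      ultimately have "p + monom 1 m * q \<in> Q (Suc m)" by (simp add: Q_def)
      moreover have "y = orbit_eval x (p + monom 1 m * q)" by (simp add: y orbit_eval_add[OF x] shift)
      ultimately show "y \<in> orbit_eval x ` Q (Suc m)" by blast
    qed
  qed
  also have "Q m \<subseteq> poly_box (m + n) (int n * B)"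
  proof
    fix p assume p: "p \<in> Q m"
    have "int (card {j. j < m \<and> j \<le> i \<and> i < j + n}) * B \<le> int n * B" for i
    proof -
      have "card {j. j < m \<and> j \<le> i \<and> i < j + n} \<le> card {i + 1 - n..<i + 1}" by (intro card_mono) auto
      also have "\<dots> \<le> n" by simp
      finally show ?thesis using B by (intro mult_right_mono) auto
    qed
    thus "p \<in> poly_box (m + n) (int n * B)" using p by (auto simp: Q_def poly_box_def intro: order_trans)
  qed
  finally show ?thesis by blast
qed

text \<open>An annihilator \<open>f\<close> makes \<open>orbit_eval x\<close> constant on classes
  modulo \<open>f\<close>, so the upper count applies to the boxes that cover the trajectories of
  \<open>F\<close>.\<close>

lemma entropy_at_orbit_le:
  assumes x: "x \<in> carrier G" and B: "B \<ge> 0" and f: "f \<noteq> 0" "f \<in> orbit_kernel x"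
    and F: "F \<subseteq> orbit_eval x ` poly_box n B" "F \<noteq> {}"
  shows "entropy_at G \<phi> F \<le> log_mahler_measure f"
proof -
  have "\<exists>K>0. \<exists>d. \<forall>m. real (card (orbit_eval x ` poly_box m (int n * B))) \<le> K * real (m + 1) ^ d * exp (log_mahler_measure f) ^ m"
  proof (rule card_residues_upper[OF f(1)])
    fix p q assume "f dvd p - q"
    then obtain s where "p - q = f * s" by (rule dvdE)
    hence "p - q \<in> orbit_kernel x" using poly_ideal_mult_right[OF poly_ideal_orbit_kernel[OF x] f(2)] by simp
    thus "orbit_eval x p = orbit_eval x q" using orbit_eval_eq_iff[OF x] by simp
  qed (use B in simp)
  then obtain K d where K: "K > 0" and Kd: "\<And>m. real (card (orbit_eval x ` poly_box m (int n * B))) \<le> K * real (m + 1) ^ d * exp (log_mahler_measure f) ^ m"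
    by blast
  have Fc: "F \<subseteq> carrier G" using F(1) x by auto
  have Ff: "finite F" using F(1) by (rule finite_subset) simp
  let ?M = "exp (log_mahler_measure f)"
  \<comment> \<open>\<open>K'\<close> absorbs the fixed extra length \<open>n\<close>, by
    \<open>m + n + 1 \<le> (n + 1) * (m + 1)\<close>.\<close>
  define K' where "K' = K * real (n + 1) ^ d * ?M ^ n"
  show ?thesis
  proof (rule lim_log_card_le[OF entropy_at_tendsto[OF Fc Ff F(2)]])
    show "K' > 0" using K by (simp add: K'_def)
    fix m
    show "card (trajectory G \<phi> F m) > 0" using Ff F(2) by (rule card_trajectory_pos)
    have "trajectory G \<phi> F m \<subseteq> orbit_eval x ` poly_box (m + n) (int n * B)"
      using trajectory_mono[OF F(1)] trajectory_orbit_eval_subset[OF x B] by (rule order_trans)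
    hence "card (trajectory G \<phi> F m) \<le> card (orbit_eval x ` poly_box (m + n) (int n * B))"
      by (intro card_mono) auto
    hence "real (card (trajectory G \<phi> F m)) \<le> K * real (m + n + 1) ^ d * ?M ^ (m + n)"
      using Kd[of "m + n"] by linarith
    also have "\<dots> \<le> K * (real (n + 1) * real (m + 1)) ^ d * ?M ^ (m + n)"
      using K by (intro mult_right_mono mult_left_mono power_mono) (auto simp: algebra_simps)
    also have "\<dots> = K' * real (m + 1) ^ d * ?M ^ m"
      by (simp add: K'_def power_mult_distrib power_add mult_ac)
    finally show "real (card (trajectory G \<phi> F m)) \<le> K' * real (m + 1) ^ d * ?M ^ m" .
  qed
qed

end

subsection \<open>Companion maps on rational vector spaces\<close>

abbreviation rat_vec_group :: "nat \<Rightarrow> rat vec monoid" where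
  "rat_vec_group n \<equiv> monoid_vec TYPE(rat) n"

lemma inv_rat_vec:
  assumes "v \<in> carrier_vec n"
  shows "inv\<^bsub>rat_vec_group n\<^esub> v = - v"
proof -
  interpret comm_group "rat_vec_group n" by (rule comm_group_vec)
  have "- v \<otimes>\<^bsub>rat_vec_group n\<^esub> v = \<one>\<^bsub>rat_vec_group n\<^esub>" using assms by (simp add: monoid_vec_simps)
  thus ?thesis using assms by (intro inv_equality) (auto simp: monoid_vec_simps)
qed

lemma vec_int_pow:
  assumes "v \<in> carrier_vec n"
  shows "v [^]\<^bsub>rat_vec_group n\<^esub> (c :: int) = of_int c \<cdot>\<^sub>v v"
proof -
  interpret comm_group "rat_vec_group n" by (rule comm_group_vec)
  have nat: "v [^]\<^bsub>rat_vec_group n\<^esub> (k :: nat) = of_nat k \<cdot>\<^sub>v v" for k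
    by (induction k) (use assms in \<open>auto simp: monoid_vec_simps algebra_simps intro!: eq_vecI\<close>)
  have "of_nat k \<cdot>\<^sub>v v \<in> carrier_vec n" for k using assms by simp
  thus ?thesis using assms
    by (auto simp: int_pow_def2 nat inv_rat_vec intro!: eq_vecI)
qed

text \<open>Multiplication by \<open>t\<close> on \<open>\<rat>[t]/(f)\<close> in the basis \<open>1, t, \<dots>, t\<^sup>n\<^sup>-\<^sup>1\<close>, where \<open>n\<close> is the degree of \<open>f\<close>.\<close>

definition companion_map :: "int poly \<Rightarrow> rat vec \<Rightarrow> rat vec" where
  "companion_map f v = vec (degree f) (\<lambda>i. (if i = 0 then 0 else v $ (i - 1))
     - v $ (degree f - 1) * of_int (coeff f i) / of_int (lead_coeff f))"

lemma companion_map_closed: "companion_map f v \<in> carrier_vec (degree f)"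
  by (simp add: companion_map_def)

lemma companion_map_hom: 
  assumes n: "degree f > 0"
  shows "companion_map f \<in> hom (rat_vec_group (degree f)) (rat_vec_group (degree f))"
  using n by (intro homI)
    (auto simp: monoid_vec_simps companion_map_closed companion_map_def algebra_simps add_divide_distrib intro!: eq_vecI)

text \<open>Since \<open>coeff f 0 \<noteq> 0\<close>, coordinate 0 of the image determines the last
  coordinate of the argument; the other coordinates are then read off from the shift.\<close>

lemma companion_map_iso:
  assumes n: "degree f > 0" and f0: "coeff f 0 \<noteq> 0"
  shows "companion_map f \<in> iso (rat_vec_group (degree f)) (rat_vec_group (degree f))"
proof -
  let ?n = "degree f"
  have lc: "lead_coeff f \<noteq> 0" using n by auto
  have "inj_on (companion_map f) (carrier_vec ?n)"
  proof (rule inj_onI)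
    fix v w assume vw: "v \<in> carrier_vec ?n" "w \<in> carrier_vec ?n" and eq: "companion_map f v = companion_map f w"
    have eqi: "companion_map f v $ i = companion_map f w $ i" for i using eq by simp
    have last: "v $ (?n - 1) = w $ (?n - 1)" using eqi[of 0] n f0 lc by (simp add: companion_map_def)
    have "v $ i = w $ i" if "i < ?n" for i
    proof (cases "i = ?n - 1")
      case True thus ?thesis using last by simp
    next
      case False
      hence "Suc i < ?n" using that by simp
      thus ?thesis using eqi[of "Suc i"] last by (simp add: companion_map_def)
    qed
    thus "v = w" using vw by (intro eq_vecI) auto
  qed
  moreover have "companion_map f ` carrier_vec ?n = carrier_vec ?n"
  proof (intro subset_antisym subsetI)
    fix w :: "rat vec" assume w: "w \<in> carrier_vec ?n"
    \<comment> \<open>\<open>l\<close> is the last coordinate of the preimage, solved from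
      coordinate 0.\<close>
    define l where "l = - w $ 0 * of_int (lead_coeff f) / of_int (coeff f 0)"
    define v where "v = vec ?n (\<lambda>i. if i = ?n - 1 then l else w $ Suc i + l * of_int (coeff f (Suc i)) / of_int (lead_coeff f))"
    have "companion_map f v = w"
    proof (rule eq_vecI)
      fix i assume "i < dim_vec w"
      hence i: "i < ?n" using w by simp
      show "companion_map f v $ i = w $ i"
      proof (cases i)
        case 0 thus ?thesis using i f0 lc by (simp add: companion_map_def v_def l_def)
      next
        case (Suc j)
        hence "j \<noteq> ?n - 1" "j < ?n" using i by auto
        thus ?thesis using i Suc by (simp add: companion_map_def v_def)
      qed
    qed (use w in \<open>simp add: companion_map_def\<close>)
    moreover have "v \<in> carrier_vec ?n" by (simp add: v_def)
    ultimately show "w \<in> companion_map f ` carrier_vec ?n" by blast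
  qed (auto simp: companion_map_closed)
  ultimately show ?thesis using companion_map_hom[OF n] by (simp add: iso_def bij_betw_def monoid_vec_simps)
qed

locale companion =
  fixes f :: "int poly"
  assumes degree_pos: "degree f > 0" and primitive: "content f = 1"
begin

sublocale group_endo "rat_vec_group (degree f)" "companion_map f"
  using degree_pos by (auto simp: group_endo_def group_endo_axioms_def comm_group_vec companion_map_hom)

text \<open>The class of the constant \<open>q\<close> in \<rat>[t]/(f). The lower bound uses
  \<open>base 1\<close>; the upper bound uses \<open>base (1 / of_int d)\<close> to absorb
  denominators.\<close>

definition base :: "rat \<Rightarrow> rat vec" where
  "base q = vec (degree f) (\<lambda>i. if i = 0 then q else 0)"

lemma base_closed: "base q \<in> carrier (rat_vec_group (degree f))"
  by (simp add: base_def monoid_vec_simps)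

lemma orbit_eval_base_pCons:
  "orbit_eval (base q) (pCons c p) = of_int c \<cdot>\<^sub>v base q + companion_map f (orbit_eval (base q) p)"
  using base_closed[of q] vec_int_pow[of "base q" "degree f" c]
  by (simp only: orbit_eval_pCons monoid_vec_simps)

text \<open>Below the degree of \<open>f\<close> multiplication by \<open>t\<close> never wraps
  around.\<close>

lemma orbit_eval_low_degree:
  "\<forall>i\<ge>degree f. coeff p i = 0 \<Longrightarrow> orbit_eval (base q) p = vec (degree f) (\<lambda>i. of_int (coeff p i) * q)"
proof (induction p)
  case 0
  show ?case by (auto simp: monoid_vec_simps)
next
  case (pCons c p)
  \<comment> \<open>The last coordinate of the vector for \<open>p\<close> is therefore zero, and
    the companion map acts on it as a pure shift.\<close>
  have z: "coeff p i = 0" if "i \<ge> degree f - 1" for i using pCons.prems that by (auto dest: spec[of _ "Suc i"])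
  hence "orbit_eval (base q) p = vec (degree f) (\<lambda>i. of_int (coeff p i) * q)" using pCons.IH by simp
  thus ?case using z degree_pos unfolding orbit_eval_base_pCons
    by (auto simp: companion_map_def base_def coeff_pCons intro!: eq_vecI split: nat.split)
qed

text \<open>In \<open>f = pCons c p\<close> the degree of \<open>p\<close> is one less than that of
  \<open>f\<close>, so a single wrap-around occurs, and it cancels every coordinate.\<close>

lemma self_in_orbit_kernel: "f \<in> orbit_kernel (base q)"
proof -
  obtain c p where f: "f = pCons c p" by (cases f) auto
  have "p \<noteq> 0" using degree_pos f by auto
  hence deg: "degree f = Suc (degree p)" using f by simp
  hence "\<forall>i\<ge>degree f. coeff p i = 0" by (auto intro: coeff_eq_0)
  note 1 = orbit_eval_low_degree[OF this, of q]
  have lc: "lead_coeff f \<noteq> 0" using degree_pos by auto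
  have lp: "coeff p (degree p) = lead_coeff f" using f \<open>p \<noteq> 0\<close> by simp
  have "orbit_eval (base q) (pCons c p) = \<one>\<^bsub>rat_vec_group (degree f)\<^esub>"
  proof (rule eq_vecI)
    fix i assume "i < dim_vec \<one>\<^bsub>rat_vec_group (degree f)\<^esub>"
    hence i: "i < degree f" by (simp add: monoid_vec_simps)
    have "coeff f i = (case i of 0 \<Rightarrow> c | Suc j \<Rightarrow> coeff p j)" unfolding f by (simp add: coeff_pCons)
    thus "orbit_eval (base q) (pCons c p) $ i = \<one>\<^bsub>rat_vec_group (degree f)\<^esub> $ i"
      using i lc unfolding orbit_eval_base_pCons 1
      by (cases i) (auto simp: monoid_vec_simps companion_map_def base_def deg lp)
  qed (simp add: orbit_eval_base_pCons companion_map_def monoid_vec_simps del: orbit_eval_pCons)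
  thus ?thesis by (simp add: orbit_kernel_def flip: f)
qed

text \<open>The pseudo-remainder modulo \<open>f\<close> annihilates \<open>base q\<close> as well
  and has low degree, so its coefficients can be read off and vanish. Primitivity of
  \<open>f\<close> removes the scalar \<open>c\<close>.\<close>

lemma orbit_kernel_dvd:
  assumes q: "q \<noteq> 0" and p: "p \<in> orbit_kernel (base q)"
  shows "f dvd p"
proof -
  have f0: "f \<noteq> 0" using degree_pos by auto
  obtain c s where c: "c \<noteq> 0" "smult c p = f * s + pseudo_mod p f"
    and deg: "pseudo_mod p f = 0 \<or> degree (pseudo_mod p f) < degree f"
    using pseudo_mod[OF f0, of p] by blast
  let ?r = "pseudo_mod p f"
  note ideal = poly_ideal_orbit_kernel[OF base_closed[of q]]
  have "smult c p - f * s \<in> orbit_kernel (base q)"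
    using ideal p self_in_orbit_kernel[of q] by (intro poly_ideal_diff poly_ideal_smult poly_ideal_mult_right)
  hence r: "?r \<in> orbit_kernel (base q)" using c(2) by simp
  have z: "\<forall>i\<ge>degree f. coeff ?r i = 0" using deg by (auto intro: coeff_eq_0)
  have v: "vec (degree f) (\<lambda>i. of_int (coeff ?r i) * q) = 0\<^sub>v (degree f)"
    using r orbit_eval_low_degree[OF z, of q] by (simp add: orbit_kernel_def monoid_vec_simps)
  have "coeff ?r i = 0" for i
  proof (cases "i < degree f")
    case True
    hence "vec (degree f) (\<lambda>i. of_int (coeff ?r i) * q) $ i = 0" unfolding v by simp
    hence "of_int (coeff ?r i) * q = 0" using True by simp
    thus ?thesis using q by simp
  next
    case False thus ?thesis using z by simp
  qed
  hence "?r = 0" by (simp add: poly_eq_iff)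
  hence "f dvd smult c p" using c(2) by simp
  thus ?thesis using primitive_dvd_smultD[OF primitive c(1)] by blast
qed

text \<open>Once \<open>d\<close> clears all denominators of \<open>F\<close>, the vectors of
  \<open>F\<close> are integer polynomials applied to \<open>base (1 / of_int d)\<close>; a single
  cyclic orbit thus contains \<open>F\<close>.\<close>

lemma common_denominator:
  assumes "finite F" "F \<subseteq> carrier_vec (degree f)"
  shows "\<exists>d>0. \<exists>B\<ge>0. F \<subseteq> orbit_eval (base (1 / of_int d)) ` poly_box (degree f) B"
proof -
  let ?n = "degree f"
  define S where "S = (\<lambda>(v, i). v $ i) ` (F \<times> {..<?n})"
  have "finite S" using assms by (simp add: S_def)
  hence "\<exists>d>0 :: int. \<forall>x\<in>S. x * of_int d \<in> \<int>"
  proof (induction S)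
    case empty show ?case by (intro exI[of _ 1]) simp
  next
    case (insert x S)
    then obtain d :: int where d: "d > 0" "\<forall>x\<in>S. x * of_int d \<in> \<int>" by blast
    obtain a b where ab: "quotient_of x = (a, b)" by fastforce
    have b: "b > 0" using quotient_of_denom_pos[OF ab] .
    have x: "x = of_int a / of_int b" using quotient_of_div[OF ab] .
    have "x * of_int (d * b) = of_int (a * d)" using b by (simp add: x)
    hence 1: "x * of_int (d * b) \<in> \<int>" by (metis Ints_of_int)
    have 2: "y * of_int (d * b) \<in> \<int>" if "y \<in> S" for y
    proof -
      have "y * of_int (d * b) = (y * of_int d) * of_int b" by simp
      also have "\<dots> \<in> \<int>" by (rule Ints_mult[OF d(2)[rule_format, OF that] Ints_of_int])
      finally show ?thesis .
    qed
    show ?case using d(1) b 1 2 by (intro exI[of _ "d * b"]) auto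
  qed
  then obtain d :: int where d: "d > 0" "\<And>x. x \<in> S \<Longrightarrow> x * of_int d \<in> \<int>" by blast
  define B where "B = (\<Sum>x\<in>S. \<bar>\<lfloor>x * of_int d\<rfloor>\<bar>)"
  have B: "\<bar>\<lfloor>x * of_int d\<rfloor>\<bar> \<le> B" if "x \<in> S" for x
    unfolding B_def using \<open>finite S\<close> that by (intro member_le_sum) auto
  have "B \<ge> 0" by (simp add: B_def sum_nonneg)
  moreover have "F \<subseteq> orbit_eval (base (1 / of_int d)) ` poly_box ?n B"
  proof
    fix v assume v: "v \<in> F"
    define p where "p = (\<Sum>i<?n. monom \<lfloor>v $ i * of_int d\<rfloor> i)"
    have cp: "coeff p i = (if i < ?n then \<lfloor>v $ i * of_int d\<rfloor> else 0)" for i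
      by (simp add: p_def coeff_sum if_distrib sum.delta' cong: if_cong)
    have S: "v $ i \<in> S" if "i < ?n" for i using v that by (force simp: S_def)
    have "orbit_eval (base (1 / of_int d)) p = vec ?n (\<lambda>i. of_int (coeff p i) * (1 / of_int d))"
      by (rule orbit_eval_low_degree) (simp add: cp)
    also have "\<dots> = v"
    proof (rule eq_vecI)
      fix i assume "i < dim_vec v"
      hence i: "i < ?n" using v assms(2) by auto
      have fl: "of_int \<lfloor>v $ i * of_int d\<rfloor> = v $ i * of_int d" using d(2)[OF S[OF i]] by (metis Ints_cases floor_of_int)
      have "vec ?n (\<lambda>i. of_int (coeff p i) * (1 / of_int d)) $ i = of_int \<lfloor>v $ i * of_int d\<rfloor> * (1 / of_int d)"
        using i by (simp add: cp)
      also have "\<dots> = v $ i" unfolding fl using d(1) by simp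
      finally show "vec ?n (\<lambda>i. of_int (coeff p i) * (1 / of_int d)) $ i = v $ i" .
    qed (use v assms(2) in auto)
    finally have "v = orbit_eval (base (1 / of_int d)) p" by simp
    moreover have "p \<in> poly_box ?n B" using B S \<open>B \<ge> 0\<close> by (auto simp: poly_box_def cp)
    ultimately show "v \<in> orbit_eval (base (1 / of_int d)) ` poly_box ?n B" by blast
  qed
  ultimately show ?thesis using d(1) by blast
qed

text \<open>The annihilator of every nonzero \<open>base q\<close> consists of the multiples of
  \<open>f\<close>, so the upper and the lower count meet at the same value.\<close>

lemma algebraic_entropy_companion_map:
  "algebraic_entropy (rat_vec_group (degree f)) (companion_map f) = ereal (log_mahler_measure f)"
proof (rule antisym)
  have f0: "f \<noteq> 0" using degree_pos by auto
  show "algebraic_entropy (rat_vec_group (degree f)) (companion_map f) \<le> ereal (log_mahler_measure f)"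
    unfolding algebraic_entropy_def
  proof (rule SUP_least)
    fix F assume "F \<in> {F. F \<subseteq> carrier (rat_vec_group (degree f)) \<and> finite F \<and> F \<noteq> {}}"
    hence F: "F \<subseteq> carrier_vec (degree f)" "finite F" "F \<noteq> {}" by (auto simp: monoid_vec_simps)
    obtain d B where "B \<ge> 0" "F \<subseteq> orbit_eval (base (1 / of_int d)) ` poly_box (degree f) B"
      using common_denominator[OF F(2,1)] by blast
    hence "entropy_at (rat_vec_group (degree f)) (companion_map f) F \<le> log_mahler_measure f"
      using entropy_at_orbit_le[OF base_closed _ f0 self_in_orbit_kernel _ F(3)] by blast
    thus "ereal (entropy_at (rat_vec_group (degree f)) (companion_map f) F) \<le> ereal (log_mahler_measure f)" by simp
  qed
  show "ereal (log_mahler_measure f) \<le> algebraic_entropy (rat_vec_group (degree f)) (companion_map f)"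
    using orbit_kernel_dvd[of 1] by (intro log_mahler_measure_le_entropy[OF base_closed[of 1] f0]) auto
qed

end

section \<open>Comparison of the three infima\<close>

text \<open>A factor t adds only the root 0, and changes neither the content nor the leading
  coefficient. A nonzero constant coefficient is what makes the companion map bijective.\<close>

lemma strip_zero_roots:
  fixes f :: "int poly"
  assumes "content f = 1"
  shows "\<exists>g. content g = 1 \<and> coeff g 0 \<noteq> 0 \<and> log_mahler_measure g = log_mahler_measure f"
  using assms
proof (induction f)
  case (pCons c p)
  show ?case
  proof (cases "c = 0")
    case False thus ?thesis using pCons.prems by (intro exI[of _ "pCons c p"]) simp
  next
    case True
    have p: "p \<noteq> 0" using pCons.hyps True by simp
    have eq: "pCons c p = [:0, 1:] * p" using True by simp
    have "content (pCons c p) = content p"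
      using True by (cases "p = 0") (auto simp: content_def)
    hence cp: "content p = 1" using pCons.prems by simp
    have "cpoly (pCons c p) = [:0, 1:] * cpoly p"
      using True by (intro poly_eqI) (simp add: coeff_map_poly coeff_pCons split: nat.split)
    moreover have "proots ([:0, 1:] * cpoly p) = proots [:0, 1:] + proots (cpoly p)"
      using p by (intro proots_mult) auto
    ultimately have "proots (cpoly (pCons c p)) = {#0#} + proots (cpoly p)"
      by (simp only: proots_linear_factor minus_zero)
    hence "log_mahler_measure (pCons c p) = log_mahler_measure p"
      using p by (simp add: log_mahler_measure_def)
    thus ?thesis using pCons.IH[OF cp] by simp
  qed
qed simp

text \<open>Each positive measure is the entropy of an automorphism: the companion map of the
  polynomial stripped of its zero roots.\<close>

lemma rat_aut_entropy_inf_le_lehmer_inf: "rat_aut_entropy_inf \<le> lehmer_inf"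
  unfolding lehmer_inf_def
proof (rule Inf_greatest, clarify)
  fix f :: "int poly" assume f: "content f = 1" and pos: "0 < log_mahler_measure f"
  obtain g where g: "content g = 1" "coeff g 0 \<noteq> 0" "log_mahler_measure g = log_mahler_measure f"
    using strip_zero_roots[OF f] by blast
  \<comment> \<open>A primitive constant is a unit and has measure 0.\<close>
  have "degree g > 0"
  proof (rule ccontr)
    assume "\<not> ?thesis"
    then obtain c where c: "g = [:c:]" by (auto elim: degree_eq_zeroE)
    hence "\<bar>c\<bar> = 1" using g(1) by simp
    hence "log_mahler_measure g = 0" unfolding c log_mahler_measure_const by (simp flip: of_int_abs)
    thus False using g(3) pos by simp
  qed
  then interpret companion g using g(1) by unfold_locales
  have eq: "ereal (log_mahler_measure f) = algebraic_entropy (rat_vec_group (degree g)) (companion_map g)"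
    using algebraic_entropy_companion_map g(3) by simp
  have "0 < algebraic_entropy (rat_vec_group (degree g)) (companion_map g)"
    unfolding eq[symmetric] using pos by simp
  thus "rat_aut_entropy_inf \<le> ereal (log_mahler_measure f)"
    unfolding rat_aut_entropy_inf_def eq
    using degree_pos companion_map_iso[OF degree_pos g(2)] by (intro Inf_lower) blast
qed

text \<open>Three inequalities between the infima close a cycle.\<close>

theorem theorem1p5:
  assumes "infinite (UNIV :: 'a set)"
  shows "entropy_inf TYPE('a) = rat_aut_entropy_inf \<and> rat_aut_entropy_inf = lehmer_inf"
  using entropy_inf_le_rat_aut_entropy_inf[OF assms] rat_aut_entropy_inf_le_lehmer_inf
    lehmer_inf_le_entropy_inf[where 'a = 'a] by (meson antisym order_trans)

end
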